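(* In $\mathbb R^8$ let $v=(1,1,0^6)$, $y=((\tfrac12)^8)$, $z=(\tfrac12,-\tfrac12,-\tfrac12,(\tfrac12)^5)$, let $W=\mathrm{span}\{v,y,z\}$, and let $C_{16}=\{x\in E_8: |x|^2=2,\ x\cdot v=0,\ x\cdot y=1,\ x\cdot z=1\}$ and $C_{10}=\{x\in E_8:|x|^2=2,\ x\cdot v=0,\ x\cdot y=1,\ x\cdot z=0\}$. Put $\widehat C_{16}=N_W(C_{16})$, $\widehat C_{10}=N_W(C_{10})$ (the Clebsch code and the cross-polytope on $\mathbb S^4$), and $C_{32}=\widehat C_{16}\cup(-\widehat C_{16})$. Then: (a) for every potential $h$ with $h^{(4)}(t)>0$ on $(-1,1)$, $m^h(\widehat C_{10})=5h(-1/\sqrt5)+5h(1/\sqrt5)$ and $m^h(C_{32})=16h(-1/\sqrt5)+16h(1/\sqrt5)$ (these lower bounds are attained), and $m^h(\widehat C_{10})/10=m^h(C_{32})/32=m^h(\widehat C_{16})/16$; (b) $(C_{32},\widehat C_{10})$ is a universal polar dual pair: for every strictly absolutely monotone $h$, the set of minimizers on $\mathbb S^4$ of $U_h(\cdot,C_{32})$ is exactly $\widehat C_{10}$ and the set of minimizers of $U_h(\cdot,\widehat C_{10})$ is exactly $C_{32}$. (Thus $(C_{32},\widehat C_{10})$ is a maximal PULB-optimal pair.)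
   Context: $E_8=\{x\in\mathbb Z^8\cup(\mathbb Z+\tfrac12)^8:\ \sum_ix_i\in2\mathbb Z\}$; $a^\ell$ inside a vector means the entry $a$ repeated $\ell$ times. For a linear subspace $W\subset\mathbb R^8$ with orthogonal projection $P_W$, and $x\notin W$, $N_W(x)=(x-P_Wx)/|x-P_Wx|$, a point of the unit sphere of $W^\perp$ ($\dim W^\perp=5$), identified with $\mathbb S^4$ by a linear isometry; $N_W(X)=\{N_W(x):x\in X\}$. A potential is $h:[-1,1]\to(-\infty,+\infty]$ continuous in the extended sense and finite on $[-1,1)$; $U_h(x,X)=\sum_{y\in X}h(x\cdot y)$, $m^h(X)=\min_{x\in\mathbb S^4}U_h(x,X)$. $h$ is strictly absolutely monotone if $h^{(j)}>0$ on $(-1,1)$ for all $j\ge0$. *)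

theory Defs
  imports "HOL-Analysis.Analysis"
begin

definition E8 :: "(real^8) set" where
  "E8 = {x. ((\<forall>i. x $ i \<in> \<int>) \<or> (\<forall>i. x $ i - 1/2 \<in> \<int>)) \<and>
            (\<exists>k::int. (\<Sum>i\<in>UNIV. x $ i) = 2 * of_int k)}"

text \<open>The coordinates of \<^typ>\<open>real^8\<close> are labelled \<open>1, \<dots>, 8\<close>, where \<open>8 = 0\<close> in the index type.\<close>

definition vec_v :: "real^8" where
  "vec_v = (\<chi> i. if i = 1 \<or> i = 2 then 1 else 0)"

definition vec_y :: "real^8" where
  "vec_y = (\<chi> i. 1/2)"

definition vec_z :: "real^8" where
  "vec_z = (\<chi> i. if i = 2 \<or> i = 3 then -1/2 else 1/2)"

definition W :: "(real^8) set" where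
  "W = span {vec_v, vec_y, vec_z}"

definition C16 :: "(real^8) set" where
  "C16 = {x \<in> E8. (norm x)\<^sup>2 = 2 \<and> x \<bullet> vec_v = 0 \<and> x \<bullet> vec_y = 1 \<and> x \<bullet> vec_z = 1}"

definition C10 :: "(real^8) set" where
  "C10 = {x \<in> E8. (norm x)\<^sup>2 = 2 \<and> x \<bullet> vec_v = 0 \<and> x \<bullet> vec_y = 1 \<and> x \<bullet> vec_z = 0}"

definition orth_proj :: "'a::euclidean_space set \<Rightarrow> 'a \<Rightarrow> 'a" where
  "orth_proj S x = (THE p. p \<in> S \<and> x - p \<in> S\<^sup>\<bottom>)"

definition normalized_rejection :: "'a::euclidean_space set \<Rightarrow> 'a \<Rightarrow> 'a" where
  "normalized_rejection S x = (x - orth_proj S x) /\<^sub>R norm (x - orth_proj S x)"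

text \<open>The unit sphere of \<open>W\<^sup>\<bottom>\<close> is identified with the unit sphere of \<^typ>\<open>real^5\<close> by a linear map
  \<open>\<phi>\<close> whose restriction to \<open>W\<^sup>\<bottom>\<close> is isometric; the values of \<open>\<phi>\<close> off \<open>W\<^sup>\<bottom>\<close> are irrelevant.\<close>

definition identifies_W_perp :: "(real^8 \<Rightarrow> real^5) \<Rightarrow> bool" where
  "identifies_W_perp \<phi> \<longleftrightarrow> linear \<phi> \<and> (\<forall>x\<in>W\<^sup>\<bottom>. norm (\<phi> x) = norm x)"

definition hatC16 :: "(real^8 \<Rightarrow> real^5) \<Rightarrow> (real^5) set" where
  "hatC16 \<phi> = \<phi> ` normalized_rejection W ` C16"

definition hatC10 :: "(real^8 \<Rightarrow> real^5) \<Rightarrow> (real^5) set" where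
  "hatC10 \<phi> = \<phi> ` normalized_rejection W ` C10"

definition C32 :: "(real^8 \<Rightarrow> real^5) \<Rightarrow> (real^5) set" where
  "C32 \<phi> = hatC16 \<phi> \<union> uminus ` hatC16 \<phi>"

definition potential :: "(real \<Rightarrow> ereal) \<Rightarrow> bool" where
  "potential h \<longleftrightarrow> continuous_on {-1..1} h \<and>
     (\<forall>t\<in>{-1..1}. h t \<noteq> -\<infinity>) \<and> (\<forall>t\<in>{-1..<1}. h t \<noteq> \<infinity>)"

text \<open>A potential is finite on \<open>(-1,1)\<close>, so \<^const>\<open>real_of_ereal\<close> loses nothing there.
  Since \<^const>\<open>deriv\<close> is total, existence of the derivatives is required explicitly.\<close>

definition nth_deriv_pos :: "nat \<Rightarrow> (real \<Rightarrow> ereal) \<Rightarrow> bool" where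
  "nth_deriv_pos n h \<longleftrightarrow>
     (\<forall>j<n. \<forall>t\<in>{-1<..<1}. (deriv ^^ j) (\<lambda>s. real_of_ereal (h s)) differentiable (at t)) \<and>
     (\<forall>t\<in>{-1<..<1}. (deriv ^^ n) (\<lambda>s. real_of_ereal (h s)) t > 0)"

definition strictly_absolutely_monotone :: "(real \<Rightarrow> ereal) \<Rightarrow> bool" where
  "strictly_absolutely_monotone h \<longleftrightarrow> (\<forall>j. nth_deriv_pos j h)"

definition U_pot :: "(real \<Rightarrow> ereal) \<Rightarrow> 'a::euclidean_space \<Rightarrow> 'a set \<Rightarrow> ereal" where
  "U_pot h x X = (\<Sum>y\<in>X. h (x \<bullet> y))"

text \<open>The infimum is a minimum for every potential and every finite code; see \<open>polarization_attained\<close>.\<close>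

definition polarization :: "(real \<Rightarrow> ereal) \<Rightarrow> 'a::euclidean_space set \<Rightarrow> ereal" where
  "polarization h X = (INF x\<in>sphere 0 1. U_pot h x X)"

definition minimizers :: "(real \<Rightarrow> ereal) \<Rightarrow> 'a::euclidean_space set \<Rightarrow> 'a set" where
  "minimizers h X = {x \<in> sphere 0 1. \<forall>x'\<in>sphere 0 1. U_pot h x X \<le> U_pot h x' X}"

definition universal_polar_dual_pair :: "'a::euclidean_space set \<Rightarrow> 'a set \<Rightarrow> bool" where
  "universal_polar_dual_pair C D \<longleftrightarrow>
     (\<forall>h. potential h \<and> strictly_absolutely_monotone h \<longrightarrow> minimizers h C = D \<and> minimizers h D = C)"

lemma orth_proj_unique:
  fixes S :: "'a::euclidean_space set"
  assumes S: "subspace S"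
  shows "\<exists>!p. p \<in> S \<and> x - p \<in> S\<^sup>\<bottom>"
proof -
  obtain p q where p: "p \<in> span S" and q: "\<And>w. w \<in> span S \<Longrightarrow> orthogonal q w" and x: "x = p + q"
    using orthogonal_subspace_decomp_exists[of S x] by metis
  have ex: "p \<in> S \<and> x - p \<in> S\<^sup>\<bottom>"
    using p q x S span_eq_iff[THEN iffD2, OF S] by (auto simp: orthogonal_comp_def orthogonal_commute)
  have "r = p" if r: "r \<in> S \<and> x - r \<in> S\<^sup>\<bottom>" for r
  proof -
    have d: "r - p \<in> S" using r ex S by (simp add: subspace_diff)
    have "(r - p) \<bullet> (x - p) = 0" "(r - p) \<bullet> (x - r) = 0"
      using d ex r by (auto simp: orthogonal_comp_def orthogonal_def)
    then have "(r - p) \<bullet> (r - p) = 0" by (simp add: inner_diff_right)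
    then show ?thesis by simp
  qed
  with ex show ?thesis by blast
qed

lemma dim_W_perp: "dim (W\<^sup>\<bottom>) = 5"
proof -
  have ne: "(3::8) \<noteq> 1" "(3::8) \<noteq> 2" "(0::8) \<noteq> 1" "(0::8) \<noteq> 2" "(0::8) \<noteq> 3" "(1::8) \<noteq> 2" "(1::8) \<noteq> 3"
    by simp_all
  have comb: "a = 0 \<and> b = 0 \<and> c = 0" if "a *\<^sub>R vec_v + b *\<^sub>R vec_y + c *\<^sub>R vec_z = 0" for a b c
  proof -
    have "(a *\<^sub>R vec_v + b *\<^sub>R vec_y + c *\<^sub>R vec_z) $ i = 0" for i using that by simp
    from this[of 1] this[of 2] this[of 3] this[of 0] ne
    show ?thesis by (simp add: vec_v_def vec_y_def vec_z_def)
  qed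
  have dist: "vec_v \<noteq> vec_y" "vec_v \<noteq> vec_z" "vec_y \<noteq> vec_z"
    using comb[of 1 "-1" 0] comb[of 1 0 "-1"] comb[of 0 1 "-1"] by auto
  have "independent {vec_v, vec_y, vec_z}"
  proof (rule independent_if_scalars_zero)
    fix f x assume s: "(\<Sum>x\<in>{vec_v, vec_y, vec_z}. f x *\<^sub>R x) = 0" and x: "x \<in> {vec_v, vec_y, vec_z}"
    show "f x = 0" using s x dist comb[of "f vec_v" "f vec_y" "f vec_z"] by (auto simp: add.assoc)
  qed simp
  then have dW: "dim W = 3"
    unfolding W_def using dist by (simp add: dim_eq_card_independent)
  have "dim {y \<in> UNIV. \<forall>x\<in>W. orthogonal x y} + dim W = dim (UNIV :: (real^8) set)"
    by (rule dim_subspace_orthogonal_to_vectors) (auto simp: W_def)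
  then have "dim (W\<^sup>\<bottom>) + 3 = 8" using dW by (simp add: orthogonal_comp_def)
  then show ?thesis by simp
qed

lemma identifies_W_perp_exists: "\<exists>\<phi>. identifies_W_perp \<phi>"
proof -
  have "dim (W\<^sup>\<bottom>) = dim (UNIV :: (real^5) set)" by (simp add: dim_W_perp)
  then obtain f :: "real^8 \<Rightarrow> real^5" and g where "linear f" "\<And>x. x \<in> W\<^sup>\<bottom> \<Longrightarrow> norm (f x) = norm x"
    using isometries_subspaces[OF subspace_orthogonal_comp subspace_UNIV] by metis
  then show ?thesis unfolding identifies_W_perp_def by blast
qed

lemma polarization_attained:
  fixes X :: "'a::euclidean_space set"
  assumes h: "potential h" and X: "finite X" "X \<subseteq> sphere 0 1"
  shows "\<exists>x\<in>sphere 0 1. U_pot h x X = polarization h X"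
proof -
  have rng: "x \<bullet> y \<in> {-1..1}" if "x \<in> sphere 0 1" "y \<in> sphere 0 1" for x y :: 'a
    using that Cauchy_Schwarz_ineq2[of x y] by auto
  have "continuous_on (sphere 0 1) (\<lambda>x. \<Sum>y\<in>Y. h (x \<bullet> y)) \<and> (\<forall>x\<in>sphere 0 1. (\<Sum>y\<in>Y. h (x \<bullet> y)) \<noteq> -\<infinity>)"
    if "finite Y" "Y \<subseteq> sphere 0 1" for Y :: "'a set"
    using that
  proof (induction Y rule: finite_induct)
    case empty
    then show ?case by simp
  next
    case (insert y Y)
    have c: "continuous_on (sphere 0 1) (\<lambda>x. h (x \<bullet> y))"
      by (rule continuous_on_compose2[of "{-1..1}" h])
        (use h insert.prems rng in \<open>auto simp: potential_def intro!: continuous_intros\<close>)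
    have n: "h (x \<bullet> y) \<noteq> -\<infinity>" if "x \<in> sphere 0 1" for x
      using h rng[OF that, of y] insert.prems by (auto simp: potential_def)
    have IH: "continuous_on (sphere 0 1) (\<lambda>x. \<Sum>y\<in>Y. h (x \<bullet> y))"
      "\<forall>x\<in>sphere 0 1. (\<Sum>y\<in>Y. h (x \<bullet> y)) \<noteq> -\<infinity>"
      using insert by auto
    have "continuous_on (sphere 0 1) (\<lambda>x. h (x \<bullet> y) + (\<Sum>y\<in>Y. h (x \<bullet> y)))"
      unfolding continuous_on_def
    proof
      fix x :: 'a assume x: "x \<in> sphere 0 1"
      show "((\<lambda>x. h (x \<bullet> y) + (\<Sum>y\<in>Y. h (x \<bullet> y))) \<longlongrightarrow> h (x \<bullet> y) + (\<Sum>y\<in>Y. h (x \<bullet> y))) (at x within sphere 0 1)"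
        by (rule tendsto_add_ereal_general) (use x n c IH in \<open>auto simp: continuous_on_def\<close>)
    qed
    then show ?case using insert.hyps n IH by auto
  qed
  then have c: "continuous_on (sphere 0 1) (\<lambda>x. U_pot h x X)" using X by (simp add: U_pot_def)
  have "sphere (0::'a) 1 \<noteq> {}" by simp
  then obtain x :: 'a where x: "x \<in> sphere 0 1" "\<forall>x'\<in>sphere 0 1. U_pot h x X \<le> U_pot h x' X"
    using continuous_attains_inf[OF compact_sphere _ c] by blast
  then have "U_pot h x X = polarization h X"
    unfolding polarization_def by (intro antisym INF_greatest INF_lower) auto
  with x show ?thesis by blast
qed

end

theory Submission
  imports Defs
begin

text \<open>The rejections of \<open>e\<^sub>3 + e\<^sub>k\<close> (\<open>k = 4, \<dots>, 8\<close>) from \<open>W\<close> form an orthonormal basis of \<open>W\<^sup>\<bottom>\<close>. In this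
  basis the code with 10 points is the cross-polytope, the one with 16 points is the demicube of the sign
  vectors divided by \<open>\<surd>5\<close> with product of signs \<open>-1\<close>, and the one with 32 points is the full cube.
  All three are spherical 3-designs. If \<open>h\<^sup>(\<^sup>4\<^sup>) > 0\<close>, then \<open>h\<close> lies above its cubic Hermite interpolant at
  \<open>\<plusminus>1/\<surd>5\<close>, strictly away from these nodes; summing the cubic over a design gives a constant. So the
  potential of each code is at least its claimed minimum, with equality exactly at the points whose inner
  products with the code are all \<open>\<plusminus>1/\<surd>5\<close>. For the cross-polytope these are the vertices of the cube,
  and conversely.\<close>

subsection \<open>Cubic Hermite interpolation\<close>

lemma Rolle_zeros:
  fixes f f' :: "real \<Rightarrow> real"
  assumes "x < y" "f x = 0" "f y = 0" and c: "continuous_on {x..y} f"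
    and d: "\<And>t. x < t \<Longrightarrow> t < y \<Longrightarrow> (f has_real_derivative f' t) (at t)"
  obtains c where "x < c" "c < y" "f' c = 0"
proof -
  have "\<exists>c. x < c \<and> c < y \<and> (f has_real_derivative 0) (at c)"
    using assms by (intro Rolle) (auto simp: real_differentiable_def)
  then show thesis using d DERIV_unique that by blast
qed

text \<open>Rolle three times: four zeros of \<open>g\<close> leave three of \<open>g1\<close>, two
  of \<open>g2\<close> and one of \<open>g3\<close>. In the application \<open>g\<close> is itself a
  first derivative, whose zeros are all interior.\<close>

lemma four_zeros_third_derivative:
  fixes g g1 g2 g3 :: "real \<Rightarrow> real"
  assumes d: "\<And>t. p \<le> t \<Longrightarrow> t \<le> s \<Longrightarrow> (g has_real_derivative g1 t) (at t)"
    "\<And>t. p \<le> t \<Longrightarrow> t \<le> s \<Longrightarrow> (g1 has_real_derivative g2 t) (at t)"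
    "\<And>t. p \<le> t \<Longrightarrow> t \<le> s \<Longrightarrow> (g2 has_real_derivative g3 t) (at t)"
    and ord: "p < q" "q < r" "r < s"
    and z: "g p = 0" "g q = 0" "g r = 0" "g s = 0"
  obtains \<xi> where "p < \<xi>" "\<xi> < s" "g3 \<xi> = 0"
proof -
  have rolle: "\<exists>c. x < c \<and> c < y \<and> f' c = 0"
    if f: "x < y" "f x = 0" "f y = 0" "p \<le> x" "y \<le> s"
      "\<And>t. p \<le> t \<Longrightarrow> t \<le> s \<Longrightarrow> (f has_real_derivative f' t) (at t)"
    for f f' :: "real \<Rightarrow> real" and x y
  proof -
    have "continuous_on {x..y} f"
      using f(4-) by (meson DERIV_isCont atLeastAtMost_iff continuous_at_imp_continuous_on order_trans)
    then obtain c where "x < c" "c < y" "f' c = 0"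
      using f Rolle_zeros[of x y f f'] by auto
    then show ?thesis by blast
  qed
  obtain a1 a2 a3 where a: "p < a1" "a1 < q" "g1 a1 = 0" "q < a2" "a2 < r" "g1 a2 = 0"
    "r < a3" "a3 < s" "g1 a3 = 0"
    using rolle[of p q g g1] rolle[of q r g g1] rolle[of r s g g1] d(1) ord z by force
  obtain b1 b2 where b: "a1 < b1" "b1 < a2" "g2 b1 = 0" "a2 < b2" "b2 < a3" "g2 b2 = 0"
    using rolle[of a1 a2 g1 g2] rolle[of a2 a3 g1 g2] d(2) a ord by force
  obtain c where "b1 < c" "c < b2" "g3 c = 0"
    using rolle[of b1 b2 g2 g3] d(3) a b ord by force
  then show thesis using a b ord that[of c] by simp
qed

text \<open>The classical error argument: subtracting a multiple of \<open>(t^2 - a^2)^2\<close>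
  that also cancels the error at \<open>t\<close> leaves a function whose fourth derivative
  \<open>f4 - 24 * K\<close> has a zero, so \<open>K > 0\<close>. For \<open>t\<close> equal to -1
  or 1 only continuity is assumed there.\<close>

lemma above_cubic_hermite_interpolant:
  fixes f f1 f2 f3 f4 H H1 :: "real \<Rightarrow> real"
  assumes d: "\<And>t. -1 < t \<Longrightarrow> t < 1 \<Longrightarrow> (f has_real_derivative f1 t) (at t)"
    "\<And>t. -1 < t \<Longrightarrow> t < 1 \<Longrightarrow> (f1 has_real_derivative f2 t) (at t)"
    "\<And>t. -1 < t \<Longrightarrow> t < 1 \<Longrightarrow> (f2 has_real_derivative f3 t) (at t)"
    "\<And>t. -1 < t \<Longrightarrow> t < 1 \<Longrightarrow> (f3 has_real_derivative f4 t) (at t)"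
    and pos: "\<And>t. -1 < t \<Longrightarrow> t < 1 \<Longrightarrow> f4 t > 0"
    and a: "0 < a" "a < 1"
    and H: "\<And>t. H t = c0 + c1 * t + c2 * t^2 + c3 * t^3"
    and H1: "\<And>t. H1 t = c1 + 2 * c2 * t + 3 * c3 * t^2"
    and ip: "H a = f a" "H (-a) = f (-a)" "H1 a = f1 a" "H1 (-a) = f1 (-a)"
    and t: "-1 \<le> t" "t \<le> 1" "t^2 \<noteq> a^2"
    and cont: "continuous_on (insert t {-1<..<1}) f"
  shows "H t < f t"
proof -
  \<comment> \<open>This \<open>K\<close> makes \<open>F t = 0\<close>, while the double zeros of
    \<open>(s^2 - a^2)^2\<close> keep \<open>F\<close> and \<open>F1\<close> zero at both
    nodes.\<close>
  define K where "K = (f t - H t) / (t^2 - a^2)^2"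
  define F where "F s = f s - H s - K * (s^2 - a^2)^2" for s
  define F1 where "F1 s = f1 s - H1 s - K * (4 * s * (s^2 - a^2))" for s
  define F2 where "F2 s = f2 s - (2 * c2 + 6 * c3 * s) - K * (12 * s^2 - 4 * a^2)" for s
  define F3 where "F3 s = f3 s - 6 * c3 - K * (24 * s)" for s
  have D: "(F has_real_derivative F1 s) (at s)" "(F1 has_real_derivative F2 s) (at s)"
    "(F2 has_real_derivative F3 s) (at s)" "(F3 has_real_derivative (f4 s - K * 24)) (at s)"
    if "-1 < s" "s < 1" for s
    unfolding F_def F1_def F2_def F3_def H H1
    by (rule derivative_eq_intros d that refl | simp add: power2_eq_square power3_eq_cube algebra_simps)+
  have ta: "t \<noteq> a" "t \<noteq> -a" using t by auto
  have F0: "F a = 0" "F (-a) = 0" "F t = 0" "F1 a = 0" "F1 (-a) = 0"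
    using ip t by (auto simp: F_def F1_def K_def)
  have Fc: "continuous_on (insert t {-1<..<1}) F"
    unfolding F_def H by (intro continuous_intros cont)
  \<comment> \<open>The first Rolle step is made on \<open>F\<close> itself: it needs only
    continuity at \<open>t\<close>, and the zeros of \<open>F1\<close> it finds are interior, where
    the higher derivatives exist.\<close>
  have rolle: "\<exists>c. x < c \<and> c < y \<and> F1 c = 0"
    if xy: "x < y" "F x = 0" "F y = 0" "x \<in> insert t {-1<..<1}" "y \<in> insert t {-1<..<1}" for x y
  proof -
    have sub: "-1 \<le> x" "y \<le> 1" using that t by auto
    have "continuous_on {x..y} F"
      by (rule continuous_on_subset[OF Fc]) (use that t in auto)
    then obtain c where "x < c" "c < y" "F1 c = 0"
      using xy(1-3) sub D(1) Rolle_zeros[of x y F F1] by auto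
    then show ?thesis by blast
  qed
  \<comment> \<open>Two zeros of \<open>F1\<close> lie between the three zeros of \<open>F\<close>,
    and two more are the nodes; only their order depends on the position of
    \<open>t\<close>.\<close>
  have "\<exists>p q r s. -1 < p \<and> p < q \<and> q < r \<and> r < s \<and> s < 1 \<and> F1 p = 0 \<and> F1 q = 0 \<and> F1 r = 0 \<and> F1 s = 0"
  proof -
    consider "t < -a" | "-a < t" "t < a" | "a < t" using ta by linarith
    then show ?thesis
    proof cases
      case 1
      obtain x y where "t < x" "x < -a" "F1 x = 0" "-a < y" "y < a" "F1 y = 0"
        using rolle[of t "-a"] rolle[of "-a" a] F0 a 1 by auto
      then show ?thesis using F0 a t by (intro exI[of _ x] exI[of _ "-a"] exI[of _ y] exI[of _ a]) auto
    next
      case 2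
      obtain x y where "-a < x" "x < t" "F1 x = 0" "t < y" "y < a" "F1 y = 0"
        using rolle[of "-a" t] rolle[of t a] F0 a 2 by auto
      then show ?thesis using F0 a t by (intro exI[of _ "-a"] exI[of _ x] exI[of _ y] exI[of _ a]) auto
    next
      case 3
      obtain x y where "-a < x" "x < a" "F1 x = 0" "a < y" "y < t" "F1 y = 0"
        using rolle[of "-a" a] rolle[of a t] F0 a 3 by auto
      then show ?thesis using F0 a t by (intro exI[of _ "-a"] exI[of _ x] exI[of _ a] exI[of _ y]) auto
    qed
  qed
  then obtain p q r s where pq: "-1 < p" "p < q" "q < r" "r < s" "s < 1"
    "F1 p = 0" "F1 q = 0" "F1 r = 0" "F1 s = 0" by blast
  obtain \<xi> where xi: "p < \<xi>" "\<xi> < s" "f4 \<xi> - K * 24 = 0"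
    by (rule four_zeros_third_derivative[of p s F1 F2 F3 "\<lambda>x. f4 x - K * 24" q r])
      (use D pq in auto)
  then have "K > 0" using pos[of \<xi>] pq by simp
  then show ?thesis using t by (simp add: K_def zero_less_divide_iff)
qed

text \<open>The system splits by parity: \<open>u + v\<close> and \<open>u' - v'\<close> determine
  \<open>c0\<close> and \<open>c2\<close>, while \<open>u - v\<close> and \<open>u' + v'\<close>
  determine \<open>c1\<close> and \<open>c3\<close>.\<close>

lemma cubic_hermite_interpolant_exists:
  fixes a u v u' v' :: real
  assumes "a > 0"
  obtains c0 c1 c2 c3 where
    "c0 + c1 * a + c2 * a^2 + c3 * a^3 = u" "c0 + c1 * (-a) + c2 * (-a)^2 + c3 * (-a)^3 = v"
    "c1 + 2 * c2 * a + 3 * c3 * a^2 = u'" "c1 + 2 * c2 * (-a) + 3 * c3 * (-a)^2 = v'"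
proof -
  define c2 where "c2 = (u' - v') / (4 * a)"
  define c3 where "c3 = ((u' + v') / 2 - (u - v) / (2 * a)) / (2 * a^2)"
  define c1 where "c1 = (u - v) / (2 * a) - c3 * a^2"
  define c0 where "c0 = (u + v) / 2 - c2 * a^2"
  have h2: "4 * a * c2 = u' - v'" and h1: "2 * a * c1 = u - v - 2 * c3 * a^3"
    and h0: "c0 = (u + v) / 2 - c2 * a^2"
    and h3: "c1 + 3 * c3 * a^2 = (u' + v') / 2"
    using assms by (auto simp: c2_def c1_def c0_def c3_def field_simps power2_eq_square power3_eq_cube)
  show thesis
    by (rule that[of c0 c1 c2 c3]) (use h0 h1 h2 h3 in \<open>auto simp: algebra_simps\<close>)
qed

text \<open>Lifts the real inequality to extended values, endpoints included. A potential can be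
  infinite only at 1, where the strict inequality is then immediate.\<close>

lemma potential_above_cubic:
  assumes h: "potential h" and h4: "nth_deriv_pos 4 h" and a: "0 < a" "a < 1"
  obtains c0 c1 c2 c3 where
    "\<And>t. t^2 = a^2 \<Longrightarrow> h t = ereal (c0 + c1 * t + c2 * t^2 + c3 * t^3)"
    "\<And>t. -1 \<le> t \<Longrightarrow> t \<le> 1 \<Longrightarrow> t^2 \<noteq> a^2 \<Longrightarrow> ereal (c0 + c1 * t + c2 * t^2 + c3 * t^3) < h t"
proof -
  define f where "f t = real_of_ereal (h t)" for t
  have hf: "h t = ereal (f t)" if "-1 \<le> t" "t < 1" for t
    using h that by (auto simp: potential_def f_def ereal_real)
  have D: "((deriv ^^ j) f has_real_derivative (deriv ^^ Suc j) f t) (at t)"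
    if "-1 < t" "t < 1" "j < 4" for j t
    using h4 that by (auto simp: nth_deriv_pos_def f_def[abs_def] DERIV_deriv_iff_real_differentiable)
  have d4: "(deriv ^^ 4) f t > 0" if "-1 < t" "t < 1" for t
    using h4 that by (auto simp: nth_deriv_pos_def f_def[abs_def])
  obtain c0 c1 c2 c3 where c:
    "c0 + c1 * a + c2 * a^2 + c3 * a^3 = f a" "c0 + c1 * (-a) + c2 * (-a)^2 + c3 * (-a)^3 = f (-a)"
    "c1 + 2 * c2 * a + 3 * c3 * a^2 = deriv f a" "c1 + 2 * c2 * (-a) + 3 * c3 * (-a)^2 = deriv f (-a)"
    using cubic_hermite_interpolant_exists[OF a(1)] by metis
  show thesis
  proof (rule that[of c0 c1 c2 c3])
    fix t :: real assume "t^2 = a^2"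
    then have "t = a \<or> t = -a" by (simp add: power2_eq_iff)
    then show "h t = ereal (c0 + c1 * t + c2 * t^2 + c3 * t^3)"
      using c hf[of a] hf[of "-a"] a by auto
  next
    fix t :: real assume t: "-1 \<le> t" "t \<le> 1" "t^2 \<noteq> a^2"
    show "ereal (c0 + c1 * t + c2 * t^2 + c3 * t^3) < h t"
    proof (cases "h t = \<infinity>")
      case False
      have ht: "h t = ereal (f t)"
        using h t False by (auto simp: potential_def f_def ereal_real)
      \<comment> \<open>All values on this set are finite, so extended continuity of
        \<open>h\<close> becomes ordinary continuity of \<open>f\<close>.\<close>
      have "continuous_on (insert t {-1<..<1}) h"
        using h t by (auto simp: potential_def intro: continuous_on_subset)
      moreover have "continuous_on (insert t {-1<..<1}) h \<longleftrightarrow>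
          continuous_on (insert t {-1<..<1}) (\<lambda>s. ereal (f s))"
        using ht hf by (intro continuous_on_cong) auto
      ultimately have cont: "continuous_on (insert t {-1<..<1}) f"
        by (simp add: continuous_on_def lim_ereal)
      have "c0 + c1 * t + c2 * t^2 + c3 * t^3 < f t"
        by (rule above_cubic_hermite_interpolant[of f "(deriv ^^ 1) f" "(deriv ^^ 2) f" "(deriv ^^ 3) f"
              "(deriv ^^ 4) f" a "\<lambda>t. c0 + c1 * t + c2 * t^2 + c3 * t^3" c0 c1 c2 c3
              "\<lambda>t. c1 + 2 * c2 * t + 3 * c3 * t^2"])
          (use D[of _ 0] D[of _ 1] D[of _ 2] D[of _ 3] d4 a c t cont in \<open>simp_all add: eval_nat_numeral\<close>)
      then show ?thesis by (simp add: ht)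
    qed simp
  qed
qed

subsection \<open>Polarization of 3-designs\<close>

text \<open>A spherical 3-design of \<open>\<real>\<^sup>n\<close> tested on zonal monomials; \<open>a\<^sup>2\<close> stands for \<open>1/n\<close>.\<close>

definition cubature_three :: "real \<Rightarrow> 'a::euclidean_space set \<Rightarrow> bool" where
  "cubature_three a X \<longleftrightarrow> finite X \<and> X \<subseteq> sphere 0 1 \<and>
     (\<forall>x\<in>sphere 0 1. (\<Sum>y\<in>X. x \<bullet> y) = 0 \<and> (\<Sum>y\<in>X. (x \<bullet> y)^2) = real (card X) * a^2 \<and> (\<Sum>y\<in>X. (x \<bullet> y)^3) = 0)"

text \<open>The equality set of the cubic bound: here every term of the potential sits at an
  interpolation node.\<close>

definition two_level_points :: "real \<Rightarrow> 'a::euclidean_space set \<Rightarrow> 'a set" where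
  "two_level_points a X = {x \<in> sphere 0 1. \<forall>y\<in>X. (x \<bullet> y)^2 = a^2}"

lemma inner_unit_bounds:
  fixes x y :: "'a::euclidean_space"
  assumes "x \<in> sphere 0 1" "y \<in> sphere 0 1"
  shows "-1 \<le> x \<bullet> y" "x \<bullet> y \<le> 1"
  using assms Cauchy_Schwarz_ineq2[of x y] by auto

text \<open>The moment conditions turn the sum of the cubic over \<open>X\<close> into
  \<open>card X * (c0 + c2 * a^2)\<close>, independently of \<open>x\<close>. The odd terms cancel
  in \<open>h (-a) + h a\<close>, so \<open>V\<close> is twice that bracket.\<close>

lemma U_pot_cubature_bound:
  fixes X :: "'a::euclidean_space set"
  assumes h: "potential h" "nth_deriv_pos 4 h" and a: "0 < a" "a < 1"
    and X: "cubature_three a X"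
  obtains V where "h (-a) + h a = ereal V"
    "\<And>x. x \<in> two_level_points a X \<Longrightarrow> U_pot h x X = ereal (real (card X) * V / 2)"
    "\<And>x. x \<in> sphere 0 1 \<Longrightarrow> x \<notin> two_level_points a X \<Longrightarrow> ereal (real (card X) * V / 2) < U_pot h x X"
proof -
  obtain c0 c1 c2 c3 where
    eq: "\<And>t. t^2 = a^2 \<Longrightarrow> h t = ereal (c0 + c1 * t + c2 * t^2 + c3 * t^3)" and
    gt: "\<And>t. -1 \<le> t \<Longrightarrow> t \<le> 1 \<Longrightarrow> t^2 \<noteq> a^2 \<Longrightarrow> ereal (c0 + c1 * t + c2 * t^2 + c3 * t^3) < h t"
    using potential_above_cubic[OF h a] by blast
  define H where "H t = c0 + c1 * t + c2 * t^2 + c3 * t^3" for t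
  define V where "V = 2 * (c0 + c2 * a^2)"
  have fin: "finite X" and sph: "X \<subseteq> sphere 0 1" using X by (auto simp: cubature_three_def)
  have tot: "(\<Sum>y\<in>X. H (x \<bullet> y)) = real (card X) * V / 2" if "x \<in> sphere 0 1" for x
  proof -
    have "(\<Sum>y\<in>X. H (x \<bullet> y)) = real (card X) * c0 + c1 * (\<Sum>y\<in>X. x \<bullet> y) + c2 * (\<Sum>y\<in>X. (x \<bullet> y)^2)
        + c3 * (\<Sum>y\<in>X. (x \<bullet> y)^3)"
      by (simp add: H_def sum.distrib sum_distrib_left)
    also have "\<dots> = real (card X) * V / 2"
      using X that by (simp add: cubature_three_def V_def algebra_simps)
    finally show ?thesis .
  qed
  show thesis
  proof (rule that[of V])
    show "h (-a) + h a = ereal V"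
      using eq[of a] eq[of "-a"] by (simp add: V_def)
  next
    fix x assume x: "x \<in> two_level_points a X"
    then have "U_pot h x X = (\<Sum>y\<in>X. ereal (H (x \<bullet> y)))"
      unfolding U_pot_def H_def two_level_points_def by (intro sum.cong) (auto simp: eq)
    then show "U_pot h x X = ereal (real (card X) * V / 2)"
      using x tot[of x] by (simp add: two_level_points_def)
  next
    fix x assume x: "x \<in> sphere 0 1" "x \<notin> two_level_points a X"
    then obtain y where y: "y \<in> X" "(x \<bullet> y)^2 \<noteq> a^2" by (auto simp: two_level_points_def)
    have ge: "ereal (H (x \<bullet> w)) \<le> h (x \<bullet> w)" if "w \<in> X" for w
      using eq[of "x \<bullet> w"] gt[of "x \<bullet> w"] inner_unit_bounds[OF x(1), of w] sph that
      unfolding H_def by (cases "(x \<bullet> w)^2 = a^2") auto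
    have "ereal (H (x \<bullet> y)) < h (x \<bullet> y)"
      using gt[of "x \<bullet> y"] y inner_unit_bounds[OF x(1), of y] sph by (auto simp: H_def)
    moreover have "(\<Sum>w\<in>X-{y}. ereal (H (x \<bullet> w))) \<le> (\<Sum>w\<in>X-{y}. h (x \<bullet> w))"
      using ge by (intro sum_mono) auto
    \<comment> \<open>One strictly larger term makes the sum strictly larger because the lower side
      is finite; the cases treat infinite values of \<open>h\<close>.\<close>
    ultimately have "ereal (H (x \<bullet> y) + (\<Sum>w\<in>X-{y}. H (x \<bullet> w))) < h (x \<bullet> y) + (\<Sum>w\<in>X-{y}. h (x \<bullet> w))"
      by (cases "h (x \<bullet> y)"; cases "\<Sum>w\<in>X-{y}. h (x \<bullet> w)") auto
    moreover have "U_pot h x X = h (x \<bullet> y) + (\<Sum>w\<in>X-{y}. h (x \<bullet> w))"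
      unfolding U_pot_def by (rule sum.remove[OF fin y(1)])
    moreover have "H (x \<bullet> y) + (\<Sum>w\<in>X-{y}. H (x \<bullet> w)) = real (card X) * V / 2"
      using tot[OF x(1)] sum.remove[OF fin y(1), of "\<lambda>w. H (x \<bullet> w)"] by simp
    ultimately show "ereal (real (card X) * V / 2) < U_pot h x X" by simp
  qed
qed

text \<open>A two-level point attains the lower bound; without one the bound would be strict
  everywhere.\<close>

lemma cubature_polarization:
  fixes X :: "'a::euclidean_space set"
  assumes h: "potential h" "nth_deriv_pos 4 h" and a: "0 < a" "a < 1"
    and X: "cubature_three a X" and ne: "two_level_points a X \<noteq> {}"
  obtains V where "h (-a) + h a = ereal V" "polarization h X = ereal (real (card X) * V / 2)"
    "\<exists>x\<in>sphere 0 1. U_pot h x X = ereal (real (card X) * V / 2)"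
proof -
  obtain V where V: "h (-a) + h a = ereal V"
    "\<And>x. x \<in> two_level_points a X \<Longrightarrow> U_pot h x X = ereal (real (card X) * V / 2)"
    "\<And>x. x \<in> sphere 0 1 \<Longrightarrow> x \<notin> two_level_points a X \<Longrightarrow> ereal (real (card X) * V / 2) < U_pot h x X"
    using U_pot_cubature_bound[OF h a X] by blast
  obtain x where x: "x \<in> two_level_points a X" using ne by blast
  then have xs: "x \<in> sphere 0 1" by (simp add: two_level_points_def)
  have "polarization h X = ereal (real (card X) * V / 2)"
    unfolding polarization_def
  proof (rule antisym)
    show "(INF x\<in>sphere 0 1. U_pot h x X) \<le> ereal (real (card X) * V / 2)"
      using INF_lower[OF xs, of "\<lambda>x. U_pot h x X"] V(2)[OF x] by simp
    show "ereal (real (card X) * V / 2) \<le> (INF x\<in>sphere 0 1. U_pot h x X)"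
      using V by (intro INF_greatest) (metis less_imp_le order_refl)
  qed
  with V x xs that show thesis by blast
qed

lemma cubature_minimizers:
  fixes X :: "'a::euclidean_space set"
  assumes h: "potential h" "nth_deriv_pos 4 h" and a: "0 < a" "a < 1"
    and X: "cubature_three a X" and ne: "two_level_points a X \<noteq> {}"
  shows "minimizers h X = two_level_points a X"
proof -
  obtain V where "h (-a) + h a = ereal V"
    and V: "\<And>x. x \<in> two_level_points a X \<Longrightarrow> U_pot h x X = ereal (real (card X) * V / 2)"
    "\<And>x. x \<in> sphere 0 1 \<Longrightarrow> x \<notin> two_level_points a X \<Longrightarrow> ereal (real (card X) * V / 2) < U_pot h x X"
    using U_pot_cubature_bound[OF h a X] by blast
  obtain z where z: "z \<in> two_level_points a X" using ne by blast
  have sub: "two_level_points a X \<subseteq> sphere 0 1" by (auto simp: two_level_points_def)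
  show ?thesis
  proof (intro set_eqI iffI)
    fix x assume "x \<in> minimizers h X"
    then have "x \<in> sphere 0 1" "U_pot h x X \<le> U_pot h z X"
      using z sub by (auto simp: minimizers_def)
    then show "x \<in> two_level_points a X"
      using V(1)[OF z] V(2)[of x] by (metis not_le)
  next
    fix x assume x: "x \<in> two_level_points a X"
    have "U_pot h x X \<le> U_pot h w X" if "w \<in> sphere 0 1" for w
      using V(1)[OF x] V(1)[of w] V(2)[OF that] by (cases "w \<in> two_level_points a X") auto
    then show "x \<in> minimizers h X" using x sub unfolding minimizers_def by auto
  qed
qed

text \<open>The antipodal union kills odd moments and doubles both the second moment and the
  cardinality; disjointness prevents double counting.\<close>

lemma cubature_three_symmetrize:
  assumes X: "cubature_three a X" and dis: "X \<inter> uminus ` X = {}"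
  shows "cubature_three a (X \<union> uminus ` X)"
proof -
  have inj: "inj_on uminus X" by (auto simp: inj_on_def)
  have fin: "finite X" and sph: "X \<subseteq> sphere 0 1" using X by (auto simp: cubature_three_def)
  have s: "(\<Sum>y\<in>X \<union> uminus ` X. f y) = (\<Sum>y\<in>X. f y) + (\<Sum>y\<in>X. f (- y))" for f :: "_ \<Rightarrow> real"
    using fin dis by (subst sum.union_disjoint) (auto simp: sum.reindex[OF inj])
  have c: "card (X \<union> uminus ` X) = 2 * card X"
    using fin dis by (subst card_Un_disjoint) (auto simp: card_image[OF inj])
  show ?thesis
    using X unfolding cubature_three_def s c by (auto simp: sum_negf power_minus_odd)
qed

subsection \<open>The cross-polytope and the cube\<close>

text \<open>Labels of the last five coordinates; the eighth one is \<open>0 :: 8\<close>.\<close>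

definition perp_index :: "8 set" where
  "perp_index = {4, 5, 6, 7, 0}"

lemma sum_perp_index: "sum f perp_index = f 4 + f 5 + f 6 + f 7 + f 0"
  for f :: "8 \<Rightarrow> 'a::comm_monoid_add"
  by (simp add: perp_index_def add.assoc)

lemma finite_perp_index [simp]: "finite perp_index" and card_perp_index: "card perp_index = 5"
  by (simp_all add: perp_index_def)

abbreviation signs :: "real set" where
  "signs \<equiv> {-1, 1}"

text \<open>The demicube consists of the sign vectors with product \<open>-1\<close>, so its fifth sign is \<open>-pqrs\<close>.\<close>

lemma sign_sum:
  "(\<Sum>p\<in>signs. \<Sum>q\<in>signs. \<Sum>r\<in>signs. \<Sum>s\<in>signs.
      p * x1 + q * x2 + r * x3 + s * x4 + - (p * q * r * s) * x5) = 0"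
  by simp

text \<open>Any four of the five signs run through all sixteen patterns once, so a monomial of
  degree at most 4 with an odd exponent sums to zero. The cubic case rests on this too.\<close>

lemma sign_square_sum:
  "(\<Sum>p\<in>signs. \<Sum>q\<in>signs. \<Sum>r\<in>signs. \<Sum>s\<in>signs.
      (p * x1 + q * x2 + r * x3 + s * x4 + - (p * q * r * s) * x5)^2) = 16 * (x1^2 + x2^2 + x3^2 + x4^2 + x5^2)"
  by simp algebra

lemma sign_cube_sum:
  "(\<Sum>p\<in>signs. \<Sum>q\<in>signs. \<Sum>r\<in>signs. \<Sum>s\<in>signs.
      (p * x1 + q * x2 + r * x3 + s * x4 + - (p * q * r * s) * x5)^3) = 0"
  by simp algebra

text \<open>Frees the geometry from \<open>\<phi>\<close>: an orthonormal family in
  \<open>real^5\<close> is all it needs. The labels stay in \<open>8\<close> so that the images of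
  \<open>perp_frame\<close> can be plugged in directly.\<close>

locale orthonormal_frame =
  fixes b :: "8 \<Rightarrow> real^5"
  assumes inner_frame: "i \<in> perp_index \<Longrightarrow> j \<in> perp_index \<Longrightarrow> b i \<bullet> b j = (if i = j then 1 else 0)"
begin

lemma inj_frame: "inj_on b perp_index"
  by (rule inj_onI) (metis inner_frame zero_neq_one)

lemma frame_expand: "x = (\<Sum>k\<in>perp_index. (x \<bullet> b k) *\<^sub>R b k)"
proof -
  have po: "pairwise orthogonal (b ` perp_index)"
    by (auto simp: pairwise_def orthogonal_def inner_frame)
  have n1: "norm w = 1" if "w \<in> b ` perp_index" for w
    using that inner_frame by (auto simp: norm_eq_1)
  have "independent (b ` perp_index)"
    using po n1 by (intro pairwise_orthogonal_independent) force+
  then have "UNIV \<subseteq> span (b ` perp_index)"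
    by (intro card_ge_dim_independent) (auto simp: card_image[OF inj_frame] card_perp_index)
  then have "(\<Sum>w\<in>b ` perp_index. (x \<bullet> w) *\<^sub>R w) = x"
    using po n1 by (intro orthonormal_basis_expand) auto
  then show ?thesis by (simp add: sum.reindex[OF inj_frame])
qed

lemma inner_expand: "x \<bullet> w = (\<Sum>k\<in>perp_index. (x \<bullet> b k) * (w \<bullet> b k))"
  by (subst frame_expand[of w]) (simp add: inner_sum_right mult.commute)

lemma frame_eqI: "(\<And>k. k \<in> perp_index \<Longrightarrow> x \<bullet> b k = w \<bullet> b k) \<Longrightarrow> x = w"
  using frame_expand[of x] frame_expand[of w] by (metis (no_types, lifting) sum.cong)

lemma unit_iff: "x \<in> sphere 0 1 \<longleftrightarrow> (\<Sum>k\<in>perp_index. (x \<bullet> b k)^2) = 1"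
  using inner_expand[of x x] by (simp add: norm_eq_1 power2_eq_square)

definition sign_point :: "real \<Rightarrow> real \<Rightarrow> real \<Rightarrow> real \<Rightarrow> real \<Rightarrow> real^5" where
  "sign_point p q r s u = (1 / sqrt 5) *\<^sub>R (p *\<^sub>R b 4 + q *\<^sub>R b 5 + r *\<^sub>R b 6 + s *\<^sub>R b 7 + u *\<^sub>R b 0)"

lemma inner_sign_point:
  "sign_point p q r s u \<bullet> b 4 = p / sqrt 5" "sign_point p q r s u \<bullet> b 5 = q / sqrt 5"
  "sign_point p q r s u \<bullet> b 6 = r / sqrt 5" "sign_point p q r s u \<bullet> b 7 = s / sqrt 5"
  "sign_point p q r s u \<bullet> b 0 = u / sqrt 5"
  by (simp_all add: sign_point_def inner_add_left inner_frame perp_index_def)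

lemma inner_sign_point_right:
  "x \<bullet> sign_point p q r s u =
     (p * (x \<bullet> b 4) + q * (x \<bullet> b 5) + r * (x \<bullet> b 6) + s * (x \<bullet> b 7) + u * (x \<bullet> b 0)) / sqrt 5"
  by (simp add: sign_point_def inner_add_right add_divide_distrib distrib_left)

lemma sign_point_minus: "- sign_point p q r s u = sign_point (-p) (-q) (-r) (-s) (-u)"
  by (simp add: sign_point_def algebra_simps)

section \<open>Demicube and cube as designs\<close>

definition demicube :: "(real^5) set" where
  "demicube = (\<lambda>(p, q, r, s). sign_point p q r s (- (p * q * r * s))) ` (signs \<times> signs \<times> signs \<times> signs)"

definition cube :: "(real^5) set" where
  "cube = demicube \<union> uminus ` demicube"

definition cross_polytope :: "(real^5) set" where
  "cross_polytope = b ` perp_index \<union> uminus ` b ` perp_index"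

lemma inj_demicube:
  "inj_on (\<lambda>(p, q, r, s). sign_point p q r s (- (p * q * r * s))) (signs \<times> signs \<times> signs \<times> signs)"
proof (rule inj_onI)
  fix c c' :: "real \<times> real \<times> real \<times> real"
  obtain p q r s p' q' r' s' where c: "c = (p, q, r, s)" "c' = (p', q', r', s')"
    by (metis prod_cases4)
  assume "(\<lambda>(p, q, r, s). sign_point p q r s (- (p * q * r * s))) c =
    (\<lambda>(p, q, r, s). sign_point p q r s (- (p * q * r * s))) c'"
  then have e: "sign_point p q r s (- (p * q * r * s)) = sign_point p' q' r' s' (- (p' * q' * r' * s'))"
    by (simp add: c)
  show "c = c'"
    using arg_cong[OF e, of "\<lambda>w. w \<bullet> b 4"] arg_cong[OF e, of "\<lambda>w. w \<bullet> b 5"]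
      arg_cong[OF e, of "\<lambda>w. w \<bullet> b 6"] arg_cong[OF e, of "\<lambda>w. w \<bullet> b 7"]
    by (simp add: inner_sign_point c)
qed

lemma card_demicube: "card demicube = 16"
  unfolding demicube_def card_image[OF inj_demicube] by (simp add: card_cartesian_product)

lemma sum_demicube:
  fixes f :: "real^5 \<Rightarrow> real"
  shows "sum f demicube = (\<Sum>p\<in>signs. \<Sum>q\<in>signs. \<Sum>r\<in>signs. \<Sum>s\<in>signs. f (sign_point p q r s (- (p * q * r * s))))"
  unfolding demicube_def sum.reindex[OF inj_demicube]
  by (simp only: sum.cartesian_product) (auto intro!: sum.cong)

lemma cubature_demicube: "cubature_three (1 / sqrt 5) demicube"
  unfolding cubature_three_def
proof (intro conjI ballI)
  show "finite demicube" by (simp add: demicube_def)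
  show "demicube \<subseteq> sphere 0 1"
    unfolding subset_iff unit_iff
    by (auto simp: demicube_def sum_perp_index inner_sign_point power_divide power_mult_distrib)
next
  fix x :: "real^5" assume "x \<in> sphere 0 1"
  then have n: "(x \<bullet> b 4)^2 + (x \<bullet> b 5)^2 + (x \<bullet> b 6)^2 + (x \<bullet> b 7)^2 + (x \<bullet> b 0)^2 = 1"
    by (simp only: unit_iff sum_perp_index)
  show "(\<Sum>y\<in>demicube. x \<bullet> y) = 0"
    by (simp only: sum_demicube inner_sign_point_right sum_divide_distrib[symmetric] sign_sum div_0)
  have "(\<Sum>y\<in>demicube. (x \<bullet> y)^2) =
      16 / 5 * ((x \<bullet> b 4)^2 + (x \<bullet> b 5)^2 + (x \<bullet> b 6)^2 + (x \<bullet> b 7)^2 + (x \<bullet> b 0)^2)"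
    by (simp only: sum_demicube inner_sign_point_right power_divide sum_divide_distrib[symmetric] sign_square_sum)
      simp
  then show "(\<Sum>y\<in>demicube. (x \<bullet> y)^2) = real (card demicube) * (1 / sqrt 5)^2"
    using n by (simp add: card_demicube power_divide)
  show "(\<Sum>y\<in>demicube. (x \<bullet> y)^3) = 0"
    by (simp only: sum_demicube inner_sign_point_right power_divide sum_divide_distrib[symmetric] sign_cube_sum div_0)
qed

text \<open>The product of the five coordinates is negative on the demicube, and negation reverses
  its sign because five is odd.\<close>

lemma demicube_disjoint: "demicube \<inter> uminus ` demicube = {}"
proof -
  have P: "(w \<bullet> b 4) * (w \<bullet> b 5) * (w \<bullet> b 6) * (w \<bullet> b 7) * (w \<bullet> b 0) < 0" if "w \<in> demicube" for w
    using that by (auto simp: demicube_def inner_sign_point)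
  show ?thesis
  proof (rule ccontr)
    assume "demicube \<inter> uminus ` demicube \<noteq> {}"
    then obtain w where "w \<in> demicube" "- w \<in> demicube" by auto
    from P[OF this(1)] P[OF this(2)] show False by simp
  qed
qed

lemma cubature_cube: "cubature_three (1 / sqrt 5) cube"
  unfolding cube_def by (rule cubature_three_symmetrize[OF cubature_demicube demicube_disjoint])

lemma card_cube: "card cube = 32"
proof -
  have "finite demicube" by (simp add: demicube_def)
  then show ?thesis
    using demicube_disjoint by (simp add: cube_def card_Un_disjoint card_image card_demicube)
qed

lemma sign_point_in_demicube:
  assumes "p \<in> signs" "q \<in> signs" "r \<in> signs" "s \<in> signs"
  shows "sign_point p q r s (- (p * q * r * s)) \<in> demicube"
  unfolding demicube_def
  by (rule rev_image_eqI[of "(p, q, r, s)"]) (use assms in \<open>simp_all only: mem_Sigma_iff prod.case\<close>)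

lemma sign_point_in_cube:
  assumes "p \<in> signs" "q \<in> signs" "r \<in> signs" "s \<in> signs" "u \<in> signs"
  shows "sign_point p q r s u \<in> cube"
proof (cases "u = - (p * q * r * s)")
  case True
  then show ?thesis using sign_point_in_demicube[OF assms(1-4)] by (simp add: cube_def)
next
  \<comment> \<open>Signs with product 1: negating all five gives product -1, a point of the
    demicube.\<close>
  case False
  then have "u = p * q * r * s" using assms by auto
  moreover have "-p \<in> signs" "-q \<in> signs" "-r \<in> signs" "-s \<in> signs" using assms by auto
  ultimately have "- sign_point p q r s u \<in> demicube"
    using sign_point_in_demicube[of "-p" "-q" "-r" "-s"] by (simp add: sign_point_minus)
  then show ?thesis unfolding cube_def by (metis UnI2 image_eqI minus_minus)
qed

text \<open>Rephrases the cube as the two-level condition against the frame; the converse reads the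
  signs off the coordinates scaled by \<open>sqrt 5\<close>.\<close>

lemma cube_iff: "x \<in> cube \<longleftrightarrow> (\<forall>k\<in>perp_index. (x \<bullet> b k)^2 = 1 / 5)"
proof
  assume "x \<in> cube"
  then show "\<forall>k\<in>perp_index. (x \<bullet> b k)^2 = 1 / 5"
    unfolding cube_def demicube_def perp_index_def
    by (auto simp: inner_sign_point power_divide power_mult_distrib)
next
  assume x: "\<forall>k\<in>perp_index. (x \<bullet> b k)^2 = 1 / 5"
  have sg: "sqrt 5 * (x \<bullet> b k) \<in> signs" if "k \<in> perp_index" for k
  proof -
    have "(x \<bullet> b k)^2 = 1 / 5" using x that by blast
    then have "(sqrt 5 * (x \<bullet> b k))^2 = 1" by (simp add: power_mult_distrib)
    then show ?thesis by (auto simp: power2_eq_1_iff)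
  qed
  have "x = sign_point (sqrt 5 * (x \<bullet> b 4)) (sqrt 5 * (x \<bullet> b 5)) (sqrt 5 * (x \<bullet> b 6))
      (sqrt 5 * (x \<bullet> b 7)) (sqrt 5 * (x \<bullet> b 0))"
    by (rule frame_eqI) (auto simp: perp_index_def inner_sign_point)
  also have "\<dots> \<in> cube" by (intro sign_point_in_cube sg) (simp_all add: perp_index_def)
  finally show "x \<in> cube" .
qed

section \<open>The cross-polytope and its duality with the cube\<close>

lemma cross_polytope_disjoint: "b ` perp_index \<inter> uminus ` b ` perp_index = {}"
proof -
  have "b i \<noteq> - b j" if "i \<in> perp_index" "j \<in> perp_index" for i j
  proof
    assume "b i = - b j"
    then have "b i \<bullet> b i = - (b j \<bullet> b i)" by (metis inner_minus_left)
    then show False using that by (simp add: inner_frame split: if_splits)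
  qed
  then show ?thesis by auto
qed

lemma card_cross_polytope: "card cross_polytope = 10"
  unfolding cross_polytope_def using cross_polytope_disjoint
  by (simp add: card_Un_disjoint card_image inj_frame card_perp_index)

lemma sum_cross_polytope:
  fixes f :: "real^5 \<Rightarrow> real"
  shows "sum f cross_polytope = (\<Sum>k\<in>perp_index. f (b k) + f (- b k))"
  unfolding cross_polytope_def using cross_polytope_disjoint
  by (simp add: sum.union_disjoint sum.reindex inj_frame sum.distrib)

lemma cubature_cross_polytope: "cubature_three (1 / sqrt 5) cross_polytope"
  unfolding cubature_three_def
proof (intro conjI ballI)
  show "finite cross_polytope" by (simp add: cross_polytope_def)
  show "cross_polytope \<subseteq> sphere 0 1"
    using inner_frame by (auto simp: cross_polytope_def norm_eq_1)
next
  fix x :: "real^5" assume "x \<in> sphere 0 1"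
  then have n: "(\<Sum>k\<in>perp_index. (x \<bullet> b k)^2) = 1" by (simp only: unit_iff)
  show "(\<Sum>y\<in>cross_polytope. x \<bullet> y) = 0" "(\<Sum>y\<in>cross_polytope. (x \<bullet> y)^3) = 0"
    by (simp_all add: sum_cross_polytope power_minus_odd)
  have "(\<Sum>y\<in>cross_polytope. (x \<bullet> y)^2) = 2 * (\<Sum>k\<in>perp_index. (x \<bullet> b k)^2)"
    by (simp add: sum_cross_polytope sum_distrib_left)
  then show "(\<Sum>y\<in>cross_polytope. (x \<bullet> y)^2) = real (card cross_polytope) * (1 / sqrt 5)^2"
    using n by (simp add: card_cross_polytope power_divide)
qed

lemma two_level_cross_polytope: "two_level_points (1 / sqrt 5) cross_polytope = cube"
proof -
  \<comment> \<open>The unit norm is automatic, since five squares of 1/5 add up to 1.\<close>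
  have "x \<in> sphere 0 1" if "x \<in> cube" for x
  proof -
    have "(\<Sum>k\<in>perp_index. (x \<bullet> b k)^2) = (\<Sum>k\<in>perp_index. 1 / 5)"
      using that unfolding cube_iff by (intro sum.cong) auto
    then show ?thesis unfolding unit_iff by (simp add: card_perp_index)
  qed
  then show ?thesis
    by (auto simp: two_level_points_def cross_polytope_def cube_iff power_divide)
qed

text \<open>For the harder inclusion, comparing cube vertices that differ only in two signs shows
  that no two coordinates of \<open>x\<close> are both nonzero; a unit vector with a single nonzero
  coordinate is a signed frame vector.\<close>

lemma two_level_cube: "two_level_points (1 / sqrt 5) cube = cross_polytope"
proof (intro set_eqI iffI)
  fix x assume x: "x \<in> cross_polytope"
  have "(x \<bullet> y)^2 = 1 / 5" if "y \<in> cube" for y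
    using x that unfolding cube_iff cross_polytope_def by (auto simp: inner_commute)
  then show "x \<in> two_level_points (1 / sqrt 5) cube"
    using x cubature_cross_polytope
    by (auto simp: two_level_points_def cubature_three_def power_divide)
next
  fix x assume "x \<in> two_level_points (1 / sqrt 5) cube"
  then have sph: "x \<in> sphere 0 1" and lev: "\<And>y. y \<in> cube \<Longrightarrow> (x \<bullet> y)^2 = 1 / 5"
    by (auto simp: two_level_points_def power_divide)
  have z: "(x \<bullet> b i) * (x \<bullet> b j) = 0" if ij: "i \<in> perp_index" "j \<in> perp_index" "i \<noteq> j" for i j
  proof -
    \<comment> \<open>\<open>R\<close> collects the other three coordinates, whose signs are held at
      1.\<close>
    define R where "R = (\<Sum>k\<in>perp_index - {i} - {j}. x \<bullet> b k)"
    have "(p * (x \<bullet> b i) + (q * (x \<bullet> b j) + R))^2 = 1" if pq: "p \<in> signs" "q \<in> signs" for p q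
    proof -
      define c where "c k = (if k = i then p else if k = j then q else 1)" for k
      define w where "w = (\<Sum>k\<in>perp_index. (c k / sqrt 5) *\<^sub>R b k)"
      have "w \<bullet> b m = c m / sqrt 5" if "m \<in> perp_index" for m
      proof -
        have "w \<bullet> b m = (\<Sum>k\<in>perp_index. if k = m then c k / sqrt 5 else 0)"
          unfolding w_def inner_sum_left using that by (intro sum.cong) (auto simp: inner_frame)
        then show ?thesis using that by simp
      qed
      moreover have "(c m)^2 = 1" for m using pq by (auto simp: c_def)
      ultimately have "w \<in> cube" by (simp add: cube_iff power_divide)
      then have "(x \<bullet> w)^2 = 1 / 5" by (rule lev)
      moreover have "x \<bullet> w = (\<Sum>k\<in>perp_index. c k * (x \<bullet> b k)) / sqrt 5"
        by (simp add: w_def inner_sum_right sum_divide_distrib)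
      moreover have "(\<Sum>k\<in>perp_index. c k * (x \<bullet> b k)) = p * (x \<bullet> b i) + (q * (x \<bullet> b j) + R)"
      proof -
        have "(\<Sum>k\<in>perp_index - {i} - {j}. c k * (x \<bullet> b k)) = R"
          unfolding R_def by (intro sum.cong) (auto simp: c_def)
        then show ?thesis
          using ij sum.remove[of perp_index i "\<lambda>k. c k * (x \<bullet> b k)"]
            sum.remove[of "perp_index - {i}" j "\<lambda>k. c k * (x \<bullet> b k)"]
          by (simp add: c_def)
      qed
      ultimately show ?thesis by (simp add: power_divide)
    qed
    then have "(1 * (x \<bullet> b i) + (1 * (x \<bullet> b j) + R))^2 = 1" "(1 * (x \<bullet> b i) + (-1 * (x \<bullet> b j) + R))^2 = 1"
      "(-1 * (x \<bullet> b i) + (1 * (x \<bullet> b j) + R))^2 = 1" "(-1 * (x \<bullet> b i) + (-1 * (x \<bullet> b j) + R))^2 = 1"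
      by blast+
    \<comment> \<open>The alternating sum of the four equations is
      \<open>8 * (x \<bullet> b i) * (x \<bullet> b j) = 0\<close>.\<close>
    then show ?thesis by algebra
  qed
  have n: "(\<Sum>k\<in>perp_index. (x \<bullet> b k)^2) = 1" using sph by (simp only: unit_iff)
  then obtain k where k: "k \<in> perp_index" "x \<bullet> b k \<noteq> 0"
    by (metis (no_types, lifting) sum.neutral zero_neq_one power_zero_numeral)
  have o: "x \<bullet> b j = 0" if "j \<in> perp_index" "j \<noteq> k" for j using z[OF k(1) that(1)] that k by auto
  have "(\<Sum>j\<in>perp_index. (x \<bullet> b j)^2) = (x \<bullet> b k)^2"
    using k o by (subst sum.remove[of _ k]) auto
  then have "x \<bullet> b k = 1 \<or> x \<bullet> b k = -1" using n by (simp add: power2_eq_1_iff)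
  moreover have "x = b k" if "x \<bullet> b k = 1"
    using that k o by (intro frame_eqI) (auto simp: inner_frame)
  moreover have "x = - b k" if "x \<bullet> b k = -1"
    using that k o by (intro frame_eqI) (auto simp: inner_frame)
  ultimately show "x \<in> cross_polytope" using k by (auto simp: cross_polytope_def)
qed

text \<open>For the code with 16 points one minimizer is enough, as only its polarization value is
  compared. A vertex of the cross-polytope serves, because the demicube lies in the cube.\<close>

lemma two_level_demicube_nonempty: "two_level_points (1 / sqrt 5) demicube \<noteq> {}"
proof -
  have "b 0 \<in> cross_polytope" by (simp add: cross_polytope_def perp_index_def)
  then have "b 0 \<in> two_level_points (1 / sqrt 5) demicube"
    unfolding two_level_cube[symmetric] by (auto simp: two_level_points_def cube_def)
  then show ?thesis by blast
qed

end

subsection \<open>The codes in coordinates of \<open>W\<^sup>\<bottom>\<close>\<close>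

lemma UNIV_8: "(UNIV :: 8 set) = {0, 1, 2, 3, 4, 5, 6, 7}"
  by (rule sym, rule card_subset_eq) simp_all

lemma forall_8: "(\<forall>i::8. P i) \<longleftrightarrow> P 0 \<and> P 1 \<and> P 2 \<and> P 3 \<and> P 4 \<and> P 5 \<and> P 6 \<and> P 7"
  using UNIV_8 by (metis UNIV_I empty_iff insert_iff)

lemma sum_8: "sum f (UNIV :: 8 set) = f 0 + f 1 + f 2 + f 3 + f 4 + f 5 + f 6 + f 7"
  for f :: "8 \<Rightarrow> 'a::comm_monoid_add"
  unfolding UNIV_8 by (simp add: add.assoc)


text \<open>\<open>perp_frame k\<close> is the rejection from \<open>W\<close> of the vector \<open>e\<^sub>3 + e\<^sub>k\<close> of \<open>C10\<close>; it has norm 1 already.\<close>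

definition perp_frame :: "8 \<Rightarrow> real^8" where
  "perp_frame k = (\<chi> i. if i = k then 3/4 else if i = 1 \<or> i = 3 then 1/4 else - 1/4)"

lemma inner_8:
  fixes x w :: "real^8"
  shows "x \<bullet> w = x$0 * w$0 + x$1 * w$1 + x$2 * w$2 + x$3 * w$3 + x$4 * w$4 + x$5 * w$5 + x$6 * w$6 + x$7 * w$7"
  by (simp add: inner_vec_def sum_8)

lemma inner_perp_frame:
  assumes "k \<in> perp_index"
  shows "x \<bullet> perp_frame k = (x$1 - x$2 + x$3) / 4 - (x$4 + x$5 + x$6 + x$7 + x$0) / 4 + x$k"
  using assms unfolding perp_index_def by (auto simp: inner_8 perp_frame_def field_simps)

lemma perp_frame_orthonormal:
  assumes "i \<in> perp_index" "j \<in> perp_index"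
  shows "perp_frame i \<bullet> perp_frame j = (if i = j then 1 else 0)"
  unfolding inner_perp_frame[OF assms(2)]
  using assms unfolding perp_index_def by (auto simp: perp_frame_def)

lemma perp_frame_in_W_perp:
  assumes "k \<in> perp_index"
  shows "perp_frame k \<in> W\<^sup>\<bottom>"
proof -
  have "orthogonal w (perp_frame k)" if "w \<in> {vec_v, vec_y, vec_z}" for w
    unfolding orthogonal_def inner_perp_frame[OF assms]
    using that assms unfolding perp_index_def by (auto simp: vec_v_def vec_y_def vec_z_def)
  then have "orthogonal (perp_frame k) w" if "w \<in> W" for w
    using that unfolding W_def by (intro orthogonal_to_span[of w]) (auto simp: orthogonal_commute)
  then show ?thesis by (auto simp: orthogonal_comp_def orthogonal_commute)
qed

section \<open>Orthogonal projection in frame coordinates\<close>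

lemma in_W_I:
  fixes p :: "real^8"
  assumes "p$5 = p$4" "p$6 = p$4" "p$7 = p$4" "p$0 = p$4" "p$1 - p$4 = p$2 - p$3"
  shows "p \<in> W"
proof -
  \<comment> \<open>Entries 4 and 3 are half the sum and half the difference of the coefficients of
    \<open>vec_y\<close> and \<open>vec_z\<close>; entry 1 then yields that of
    \<open>vec_v\<close>.\<close>
  have "p = (p$1 - p$4) *\<^sub>R vec_v + (p$4 + p$3) *\<^sub>R vec_y + (p$4 - p$3) *\<^sub>R vec_z"
    unfolding vec_eq_iff forall_8 using assms
    by (simp add: vec_v_def vec_y_def vec_z_def field_simps)
  also have "\<dots> \<in> W"
    unfolding W_def by (intro span_add span_mul span_base) auto
  finally show ?thesis .
qed

text \<open>The frame sum lies in the complement and the remainder is checked to lie in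
  \<open>W\<close>; uniqueness of the decomposition does the rest. The second check is what shows
  that the frame spans the complement.\<close>

lemma rejection_W: "x - orth_proj W x = (\<Sum>k\<in>perp_index. (x \<bullet> perp_frame k) *\<^sub>R perp_frame k)"
proof -
  define s where "s = (\<Sum>k\<in>perp_index. (x \<bullet> perp_frame k) *\<^sub>R perp_frame k)"
  have s: "s \<in> W\<^sup>\<bottom>"
    unfolding s_def by (intro subspace_sum subspace_mul subspace_orthogonal_comp perp_frame_in_W_perp)
  have m: "(4::8) \<in> perp_index" "(5::8) \<in> perp_index" "(6::8) \<in> perp_index" "(7::8) \<in> perp_index" "(0::8) \<in> perp_index"
    by (simp_all add: perp_index_def)
  have "x - s \<in> W"
    by (rule in_W_I)
      (simp_all add: s_def sum_perp_index inner_perp_frame m, simp_all add: perp_frame_def field_simps)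
  then have "orth_proj W x = x - s"
    unfolding orth_proj_def using s
    by (intro the1_equality orth_proj_unique) (auto simp: W_def)
  then show ?thesis by (simp add: s_def)
qed

lemma norm_rejection_W: "(norm (x - orth_proj W x))^2 = (\<Sum>k\<in>perp_index. (x \<bullet> perp_frame k)^2)"
proof -
  have "(norm (x - orth_proj W x))^2 = (\<Sum>i\<in>perp_index. \<Sum>j\<in>perp_index.
      (x \<bullet> perp_frame i) * (x \<bullet> perp_frame j) * (perp_frame i \<bullet> perp_frame j))"
    unfolding rejection_W power2_norm_eq_inner
    by (simp add: inner_sum_left inner_sum_right sum_distrib_left mult.assoc mult.left_commute inner_commute)
  also have "\<dots> = (\<Sum>i\<in>perp_index. \<Sum>j\<in>perp_index. if i = j then (x \<bullet> perp_frame i)^2 else 0)"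
    by (intro sum.cong refl) (auto simp: perp_frame_orthonormal power2_eq_square)
  also have "\<dots> = (\<Sum>k\<in>perp_index. (x \<bullet> perp_frame k)^2)" by simp
  finally show ?thesis .
qed

text \<open>A vector of \<open>C10\<close> has integral coordinates \<open>x\<^sub>1 + x\<^sub>k\<close> in the frame and a rejection of norm 1.\<close>

lemma C10_D:
  assumes "x \<in> C10"
  obtains k e where "k \<in> perp_index" "e \<in> signs"
    "\<And>j. j \<in> perp_index \<Longrightarrow> x \<bullet> perp_frame j = (if j = k then e else 0)"
proof -
  have E: "x \<in> E8" and n: "x \<bullet> x = 2" and v: "x \<bullet> vec_v = 0" "x \<bullet> vec_y = 1" "x \<bullet> vec_z = 0"
    using assms by (auto simp: C10_def power2_norm_eq_inner)
  \<comment> \<open>\<open>vec_y - vec_z\<close> is the sum of the second and third unit vectors,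
    whence \<open>x$2 + x$3 = 1\<close>.\<close>
  have c: "x$2 = - x$1" "x$3 = 1 + x$1" "x$4 + x$5 + x$6 + x$7 + x$0 = 1 - x$1"
    using v by (simp_all add: inner_8 vec_v_def vec_y_def vec_z_def)
  have t: "x \<bullet> perp_frame k = x$1 + x$k" if "k \<in> perp_index" for k
    unfolding inner_perp_frame[OF that] c by (simp add: field_simps)
  have int: "x \<bullet> perp_frame k \<in> \<int>" if "k \<in> perp_index" for k
  proof (cases "\<forall>i. x$i \<in> \<int>")
    case False
    then have "(x$1 - 1/2) + (x$k - 1/2) + 1 \<in> \<int>"
      using E unfolding E8_def by (intro Ints_add Ints_1) auto
    then show ?thesis by (simp add: t that)
  qed (simp add: t that)
  have "(\<Sum>k\<in>perp_index. (x \<bullet> perp_frame k)^2) = (\<Sum>k\<in>perp_index. (x$1 + x$k)^2)"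
    by (simp add: t)
  also have "\<dots> = 1"
  proof -
    have x0: "x$0 = 1 - x$1 - x$4 - x$5 - x$6 - x$7" using c(3) by linarith
    show ?thesis
      using n unfolding inner_8 sum_perp_index c(1,2) x0 by (simp add: power2_eq_square field_simps)
  qed
  finally have one: "(\<Sum>k\<in>perp_index. (x \<bullet> perp_frame k)^2) = 1" .
  \<comment> \<open>Integers whose squares add up to 1: one of them is 1 or -1 and the rest
    vanish.\<close>
  then obtain k where k: "k \<in> perp_index" "x \<bullet> perp_frame k \<noteq> 0"
    by (metis (no_types, lifting) sum.neutral zero_neq_one power_zero_numeral)
  then have "1 \<le> \<bar>x \<bullet> perp_frame k\<bar>" using int Ints_nonzero_abs_ge1 by blast
  then have ge: "1 \<le> (x \<bullet> perp_frame k)^2" by (metis one_power2 power2_abs power_mono zero_le_one)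
  have split: "(x \<bullet> perp_frame k)^2 + (\<Sum>j\<in>perp_index-{k}. (x \<bullet> perp_frame j)^2) = 1"
    using one k by (simp add: sum.remove[OF finite_perp_index k(1), of "\<lambda>j. (x \<bullet> perp_frame j)^2"])
  moreover have nn: "0 \<le> (\<Sum>j\<in>perp_index-{k}. (x \<bullet> perp_frame j)^2)" by (intro sum_nonneg) auto
  ultimately have z: "(\<Sum>j\<in>perp_index-{k}. (x \<bullet> perp_frame j)^2) = 0" using ge by linarith
  have o: "x \<bullet> perp_frame j = 0" if "j \<in> perp_index" "j \<noteq> k" for j
    using z that by (subst (asm) sum_nonneg_eq_0_iff) auto
  have "(x \<bullet> perp_frame k)^2 = 1" using split z by simp
  then have "x \<bullet> perp_frame k \<in> signs" by (auto simp: power2_eq_1_iff)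
  with k o show thesis by (intro that[of k "x \<bullet> perp_frame k"]) auto
qed

text \<open>The witnesses solve \<open>x$1 + x$j = (if j = k then e else 0)\<close> together with
  the linear equations of \<open>C10\<close>; this forces \<open>x$1 = 0\<close> for
  \<open>e = 1\<close> and \<open>x$1 = -1/2\<close> for \<open>e = -1\<close>.\<close>

lemma C10_I:
  assumes k: "k \<in> perp_index" and e: "e \<in> signs"
  obtains x where "x \<in> C10" "\<And>j. j \<in> perp_index \<Longrightarrow> x \<bullet> perp_frame j = (if j = k then e else 0)"
proof (cases "e = 1")
  case True
  define x :: "real^8" where "x = (\<chi> i. if i = 3 \<or> i = k then 1 else 0)"
  have s: "(\<Sum>i\<in>UNIV. x$i) = 2"
    using k by (auto simp: x_def sum_8 perp_index_def)
  have "x \<in> E8"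
    unfolding E8_def using s by (auto simp: x_def intro!: exI[of _ "1::int"])
  moreover have "x \<bullet> x = 2" "x \<bullet> vec_v = 0" "x \<bullet> vec_y = 1" "x \<bullet> vec_z = 0"
    using k by (auto simp: x_def inner_8 vec_v_def vec_y_def vec_z_def perp_index_def)
  ultimately have "x \<in> C10" by (simp add: C10_def power2_norm_eq_inner)
  moreover have "x \<bullet> perp_frame j = (if j = k then e else 0)" if "j \<in> perp_index" for j
    unfolding inner_perp_frame[OF that] using k that True by (auto simp: x_def perp_index_def)
  ultimately show thesis by (rule that)
next
  case False
  define x :: "real^8" where "x = (\<chi> i. if i = 1 \<or> i = k then -1/2 else 1/2)"
  have s: "(\<Sum>i\<in>UNIV. x$i) = 2"
    using k by (auto simp: x_def sum_8 perp_index_def)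
  have "x \<in> E8"
    unfolding E8_def using s by (auto simp: x_def intro!: exI[of _ "1::int"])
  moreover have "x \<bullet> x = 2" "x \<bullet> vec_v = 0" "x \<bullet> vec_y = 1" "x \<bullet> vec_z = 0"
    using k by (auto simp: x_def inner_8 vec_v_def vec_y_def vec_z_def perp_index_def)
  ultimately have "x \<in> C10" by (simp add: C10_def power2_norm_eq_inner)
  moreover have "x \<bullet> perp_frame j = (if j = k then e else 0)" if "j \<in> perp_index" for j
    unfolding inner_perp_frame[OF that] using k that e False by (auto simp: x_def perp_index_def)
  ultimately show thesis by (rule that)
qed

text \<open>With \<open>n\<close> minus signs the sum is \<open>5 - 2 * n\<close>, which is -1
  modulo 4 exactly when \<open>n\<close> is odd, that is, when the product of all five is
  -1.\<close>

lemma sign_parity: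
  assumes "p \<in> signs" "q \<in> signs" "r \<in> signs" "s \<in> signs" "u \<in> signs"
    and "p + q + r + s + u = 4 * of_int m - 1"
  shows "u = - (p * q * r * s)"
proof -
  have "4 * real_of_int m \<noteq> of_int l" if "l mod 4 = 2" for l
    using that by (metis mod_mult_self1_is_0 of_int_eq_iff of_int_mult of_int_numeral zero_neq_numeral)
  \<comment> \<open>These are the values of the sum plus 1 for an even number of minus
    signs.\<close>
  from this[of 2] this[of 6] this[of "-2"] show ?thesis using assms by auto
qed

text \<open>A vector of \<open>C16\<close> has coordinates \<open>x\<^sub>1 + x\<^sub>k - 1/2\<close> in the frame. They are half-integral with
  squares summing to \<open>5/4\<close>, hence all \<open>\<plusminus>1/2\<close>; their sum is \<open>4 x\<^sub>1 - 1/2\<close>, which fixes the parity.\<close>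

lemma C16_D:
  assumes "x \<in> C16"
  obtains p q r s where "p \<in> signs" "q \<in> signs" "r \<in> signs" "s \<in> signs"
    "x \<bullet> perp_frame 4 = p / 2" "x \<bullet> perp_frame 5 = q / 2" "x \<bullet> perp_frame 6 = r / 2"
    "x \<bullet> perp_frame 7 = s / 2" "x \<bullet> perp_frame 0 = - (p * q * r * s) / 2"
proof -
  have E: "x \<in> E8" and n: "x \<bullet> x = 2" and v: "x \<bullet> vec_v = 0" "x \<bullet> vec_y = 1" "x \<bullet> vec_z = 1"
    using assms by (auto simp: C16_def power2_norm_eq_inner)
  have c: "x$2 = - x$1" "x$3 = x$1" "x$4 + x$5 + x$6 + x$7 + x$0 = 2 - x$1"
    using v by (simp_all add: inner_8 vec_v_def vec_y_def vec_z_def)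
  have t: "x \<bullet> perp_frame k = x$1 + x$k - 1/2" if "k \<in> perp_index" for k
    unfolding inner_perp_frame[OF that] c by (simp add: field_simps)
  have m: "(4::8) \<in> perp_index" "(5::8) \<in> perp_index" "(6::8) \<in> perp_index" "(7::8) \<in> perp_index" "(0::8) \<in> perp_index"
    by (simp_all add: perp_index_def)
  have int: "x$1 + x$k \<in> \<int>" for k
  proof (cases "\<forall>i. x$i \<in> \<int>")
    case False
    then have "(x$1 - 1/2) + (x$k - 1/2) + 1 \<in> \<int>"
      using E unfolding E8_def by (intro Ints_add Ints_1) auto
    then show ?thesis by simp
  qed simp
  have ge: "1/4 \<le> (x \<bullet> perp_frame k)^2" if "k \<in> perp_index" for k
  proof -
    obtain l :: int where l: "x$1 + x$k = of_int l" using int Ints_cases by blast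
    \<comment> \<open>A half-integer has square at least 1/4; for \<open>l - 1/2\<close> this
      amounts to the inequality below.\<close>
    have "0 \<le> l * (l - 1)" by (cases "l \<le> 0") (auto simp: mult_nonpos_nonpos)
    then have "0 \<le> real_of_int l * (real_of_int l - 1)"
      by (metis of_int_0_le_iff of_int_1 of_int_diff of_int_mult)
    then show ?thesis unfolding t[OF that] l by (simp add: power2_eq_square algebra_simps)
  qed
  have "(\<Sum>k\<in>perp_index. (x \<bullet> perp_frame k)^2) = (\<Sum>k\<in>perp_index. (x$1 + x$k - 1/2)^2)"
    by (simp add: t)
  also have "\<dots> = 5/4"
  proof -
    have x0: "x$0 = 2 - x$1 - x$4 - x$5 - x$6 - x$7" using c(3) by linarith
    show ?thesis
      using n unfolding inner_8 sum_perp_index c(1,2) x0 by (simp add: power2_eq_square field_simps)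
  qed
  \<comment> \<open>Five terms bounded below by 1/4 with total 5/4 are all equal to 1/4.\<close>
  finally have "(\<Sum>k\<in>perp_index. (x \<bullet> perp_frame k)^2 - 1/4) = 0"
    by (simp add: sum_subtractf card_perp_index)
  then have q: "(x \<bullet> perp_frame k)^2 = 1/4" if "k \<in> perp_index" for k
    using ge that by (subst (asm) sum_nonneg_eq_0_iff) auto
  have sg: "2 * (x \<bullet> perp_frame k) \<in> signs" if "k \<in> perp_index" for k
  proof -
    have "(2 * (x \<bullet> perp_frame k))^2 = 1" using q[OF that] by (simp add: power_mult_distrib)
    then show ?thesis unfolding power2_eq_1_iff by blast
  qed
  \<comment> \<open>Here \<open>l\<close> is \<open>2 * x$1\<close>; the doubled frame coordinates
    add up to \<open>8 * x$1 - 1\<close>, the form that \<open>sign_parity\<close> expects.\<close>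
  obtain l :: int where l: "x$1 + x$1 = of_int l" using int Ints_cases by blast
  have "2 * (x \<bullet> perp_frame 0) = - ((2 * (x \<bullet> perp_frame 4)) * (2 * (x \<bullet> perp_frame 5)) *
      (2 * (x \<bullet> perp_frame 6)) * (2 * (x \<bullet> perp_frame 7)))"
  proof (rule sign_parity[OF sg sg sg sg sg])
    show "2 * (x \<bullet> perp_frame 4) + 2 * (x \<bullet> perp_frame 5) + 2 * (x \<bullet> perp_frame 6) +
        2 * (x \<bullet> perp_frame 7) + 2 * (x \<bullet> perp_frame 0) = 4 * of_int l - 1"
      using l c by (simp add: t m)
  qed (rule m)+
  then show thesis
    using sg[OF m(1)] sg[OF m(2)] sg[OF m(3)] sg[OF m(4)]
    by (intro that[of "2 * (x \<bullet> perp_frame 4)" "2 * (x \<bullet> perp_frame 5)" "2 * (x \<bullet> perp_frame 6)"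
          "2 * (x \<bullet> perp_frame 7)"]) linarith+
qed

lemma C16_I:
  assumes sg: "p \<in> signs" "q \<in> signs" "r \<in> signs" "s \<in> signs"
  obtains x where "x \<in> C16"
    "x \<bullet> perp_frame 4 = p / 2" "x \<bullet> perp_frame 5 = q / 2" "x \<bullet> perp_frame 6 = r / 2"
    "x \<bullet> perp_frame 7 = s / 2" "x \<bullet> perp_frame 0 = - (p * q * r * s) / 2"
proof -
  define u where "u = - (p * q * r * s)"
  \<comment> \<open>Inverts the frame coordinates: the five signs must add up to
    \<open>8 * x$1 - 1\<close>, which determines \<open>x$1\<close>.\<close>
  define a where "a = (p + q + r + s + u + 1) / 8"
  define x :: "real^8" where "x = (\<chi> i. if i = 1 \<or> i = 3 then a else if i = 2 then - a else
     (if i = 4 then p else if i = 5 then q else if i = 6 then r else if i = 7 then s else u) / 2 + 1/2 - a)"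
  have nth: "x$0 = u/2 + 1/2 - a" "x$1 = a" "x$2 = -a" "x$3 = a" "x$4 = p/2 + 1/2 - a" "x$5 = q/2 + 1/2 - a"
    "x$6 = r/2 + 1/2 - a" "x$7 = s/2 + 1/2 - a"
    by (simp_all add: x_def)
  have sq: "p^2 = 1" "q^2 = 1" "r^2 = 1" "s^2 = 1" "u^2 = 1"
    using sg by (auto simp: u_def power_mult_distrib)
  \<comment> \<open>By the parity of the signs, \<open>a\<close> is 0, 1/2 or -1/2; all entries are
    integral in the first case and half-integral in the others.\<close>
  have "(\<forall>i. x$i \<in> \<int>) \<or> (\<forall>i. x$i - 1/2 \<in> \<int>)"
    unfolding forall_8 nth using sg by (elim insertE emptyE) (simp_all add: a_def u_def)
  moreover have s2: "(\<Sum>i\<in>UNIV. x$i) = 2"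
    unfolding sum_8 nth by (simp add: a_def field_simps)
  ultimately have "x \<in> E8"
    unfolding E8_def by (auto intro!: exI[of _ "1::int"])
  moreover have "x \<bullet> vec_v = 0" "x \<bullet> vec_y = 1" "x \<bullet> vec_z = 1"
    by (simp_all add: inner_8 nth vec_v_def vec_y_def vec_z_def) (simp_all add: a_def field_simps)
  moreover have "x \<bullet> x = 2"
  proof -
    have sqr: "(t/2 + 1/2 - a) * (t/2 + 1/2 - a) = 1/4 + t * (1/2 - a) + (1/2 - a)^2" if "t^2 = 1" for t
      using that by (simp add: power2_eq_square field_simps)
    have t: "p + q + r + s + u = 8 * a - 1" by (simp add: a_def field_simps)
    have "x \<bullet> x = 5/4 + (p + q + r + s + u) * (1/2 - a) + 5 * (1/2 - a)^2 + 3 * a^2"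
      unfolding inner_8 nth sqr[OF sq(1)] sqr[OF sq(2)] sqr[OF sq(3)] sqr[OF sq(4)] sqr[OF sq(5)]
      by (simp add: power2_eq_square algebra_simps)
    then show ?thesis unfolding t by (simp add: power2_eq_square field_simps)
  qed
  ultimately have "x \<in> C16" by (simp add: C16_def power2_norm_eq_inner)
  moreover have "x \<bullet> perp_frame 4 = p / 2" "x \<bullet> perp_frame 5 = q / 2" "x \<bullet> perp_frame 6 = r / 2"
    "x \<bullet> perp_frame 7 = s / 2" "x \<bullet> perp_frame 0 = u / 2"
    by (simp_all add: inner_perp_frame perp_index_def nth) (simp_all add: a_def field_simps)
  ultimately show thesis using that by (simp add: u_def)
qed


section \<open>Transport of the codes to \<open>real^5\<close>\<close>

lemma isometry_inner_W_perp:
  assumes "identifies_W_perp \<phi>" "u \<in> W\<^sup>\<bottom>" "w \<in> W\<^sup>\<bottom>"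
  shows "\<phi> u \<bullet> \<phi> w = u \<bullet> w"
proof -
  \<comment> \<open>\<open>\<phi>\<close> is known to preserve norms only on the complement, so the
    polarization identity needs the sum to lie there as well.\<close>
  have "u + w \<in> W\<^sup>\<bottom>" using assms by (simp add: subspace_add subspace_orthogonal_comp)
  moreover have "\<phi> (u + w) = \<phi> u + \<phi> w" using assms by (simp add: identifies_W_perp_def linear_add)
  ultimately show ?thesis using assms unfolding identifies_W_perp_def dot_norm by metis
qed

lemma orthonormal_frame_image:
  assumes "identifies_W_perp \<phi>"
  shows "orthonormal_frame (\<lambda>k. \<phi> (perp_frame k))"
  using assms by unfold_locales (simp add: isometry_inner_W_perp perp_frame_in_W_perp perp_frame_orthonormal)

text \<open>The norm of the rejection enters as a parameter because it is constant on each code: 1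
  on \<open>C10\<close> and \<open>sqrt 5 / 2\<close> on \<open>C16\<close>.\<close>

lemma inner_normalized_rejection:
  assumes \<phi>: "identifies_W_perp \<phi>" and k: "k \<in> perp_index"
    and n: "(\<Sum>j\<in>perp_index. (x \<bullet> perp_frame j)^2) = n^2" "n > 0"
  shows "\<phi> (normalized_rejection W x) \<bullet> \<phi> (perp_frame k) = (x \<bullet> perp_frame k) / n"
proof -
  have nn: "norm (x - orth_proj W x) = n"
    using norm_rejection_W[of x] n by (simp add: power2_eq_iff_nonneg)
  have "x - orth_proj W x \<in> W\<^sup>\<bottom>"
    unfolding rejection_W by (intro subspace_sum subspace_mul subspace_orthogonal_comp perp_frame_in_W_perp)
  then have "normalized_rejection W x \<in> W\<^sup>\<bottom>"
    unfolding normalized_rejection_def by (intro subspace_mul subspace_orthogonal_comp)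
  then have "\<phi> (normalized_rejection W x) \<bullet> \<phi> (perp_frame k) = normalized_rejection W x \<bullet> perp_frame k"
    using \<phi> k by (simp add: isometry_inner_W_perp perp_frame_in_W_perp)
  also have "\<dots> = ((x - orth_proj W x) \<bullet> perp_frame k) / n"
    by (simp add: normalized_rejection_def nn divide_inverse mult.commute)
  also have "(x - orth_proj W x) \<bullet> perp_frame k =
      (\<Sum>j\<in>perp_index. if j = k then x \<bullet> perp_frame j else 0)"
    unfolding rejection_W inner_sum_left using k
    by (intro sum.cong) (auto simp: perp_frame_orthonormal)
  also have "\<dots> = x \<bullet> perp_frame k" using k by simp
  finally show ?thesis .
qed

lemma hatC10_eq_cross_polytope:
  assumes \<phi>: "identifies_W_perp \<phi>"
  shows "hatC10 \<phi> = orthonormal_frame.cross_polytope (\<lambda>k. \<phi> (perp_frame k))"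
proof -
  interpret F: orthonormal_frame "\<lambda>k. \<phi> (perp_frame k)" by (rule orthonormal_frame_image[OF \<phi>])
  have img: "\<phi> (normalized_rejection W x) = e *\<^sub>R \<phi> (perp_frame k)"
    if k: "k \<in> perp_index" and e: "e \<in> signs"
      and x: "\<And>j. j \<in> perp_index \<Longrightarrow> x \<bullet> perp_frame j = (if j = k then e else 0)" for x k e
  proof (rule F.frame_eqI)
    fix j assume j: "j \<in> perp_index"
    have "(\<Sum>j\<in>perp_index. (x \<bullet> perp_frame j)^2) = (\<Sum>j\<in>perp_index. if j = k then 1 else 0)"
      using e by (intro sum.cong) (auto simp: x)
    then have "(\<Sum>j\<in>perp_index. (x \<bullet> perp_frame j)^2) = 1^2" using k by simp
    from inner_normalized_rejection[OF \<phi> j this]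
    show "\<phi> (normalized_rejection W x) \<bullet> \<phi> (perp_frame j) = (e *\<^sub>R \<phi> (perp_frame k)) \<bullet> \<phi> (perp_frame j)"
      using j k by (auto simp: x F.inner_frame)
  qed
  have cp: "w \<in> F.cross_polytope \<longleftrightarrow> (\<exists>e\<in>signs. \<exists>k\<in>perp_index. w = e *\<^sub>R \<phi> (perp_frame k))" for w
    by (auto simp: F.cross_polytope_def)
  show ?thesis
  proof (intro set_eqI iffI)
    fix w assume "w \<in> hatC10 \<phi>"
    then obtain x where x: "x \<in> C10" "w = \<phi> (normalized_rejection W x)" by (auto simp: hatC10_def)
    obtain k e where ke: "k \<in> perp_index" "e \<in> signs"
      "\<And>j. j \<in> perp_index \<Longrightarrow> x \<bullet> perp_frame j = (if j = k then e else 0)"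
      using C10_D[OF x(1)] by metis
    show "w \<in> F.cross_polytope" unfolding cp x(2) using img[OF ke] ke(1,2) by blast
  next
    fix w assume "w \<in> F.cross_polytope"
    then obtain k e where ke: "k \<in> perp_index" "e \<in> signs" and w: "w = e *\<^sub>R \<phi> (perp_frame k)"
      unfolding cp by blast
    obtain x where x: "x \<in> C10" "\<And>j. j \<in> perp_index \<Longrightarrow> x \<bullet> perp_frame j = (if j = k then e else 0)"
      using C10_I[OF ke] by metis
    have "w = \<phi> (normalized_rejection W x)" using img[OF ke x(2)] w by simp
    then show "w \<in> hatC10 \<phi>" unfolding hatC10_def using x(1) by blast
  qed
qed

lemma hatC16_eq_demicube:
  assumes \<phi>: "identifies_W_perp \<phi>"
  shows "hatC16 \<phi> = orthonormal_frame.demicube (\<lambda>k. \<phi> (perp_frame k))"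
proof -
  interpret F: orthonormal_frame "\<lambda>k. \<phi> (perp_frame k)" by (rule orthonormal_frame_image[OF \<phi>])
  have img: "\<phi> (normalized_rejection W x) = F.sign_point p q r s (- (p * q * r * s))"
    if sg: "p \<in> signs" "q \<in> signs" "r \<in> signs" "s \<in> signs"
      and x: "x \<bullet> perp_frame 4 = p / 2" "x \<bullet> perp_frame 5 = q / 2" "x \<bullet> perp_frame 6 = r / 2"
        "x \<bullet> perp_frame 7 = s / 2" "x \<bullet> perp_frame 0 = - (p * q * r * s) / 2" for x p q r s
  proof (rule F.frame_eqI)
    fix j assume j: "j \<in> perp_index"
    have "p^2 = 1" "q^2 = 1" "r^2 = 1" "s^2 = 1" using sg by auto
    \<comment> \<open>Dividing coordinates of modulus 1/2 by this norm gives the modulus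
      \<open>1 / sqrt 5\<close> of a sign point.\<close>
    then have "(\<Sum>j\<in>perp_index. (x \<bullet> perp_frame j)^2) = (sqrt 5 / 2)^2"
      by (simp add: sum_perp_index x power_divide power_mult_distrib)
    from inner_normalized_rejection[OF \<phi> j this]
    show "\<phi> (normalized_rejection W x) \<bullet> \<phi> (perp_frame j) =
        F.sign_point p q r s (- (p * q * r * s)) \<bullet> \<phi> (perp_frame j)"
      using j unfolding perp_index_def by (elim insertE emptyE) (simp_all add: x F.inner_sign_point)
  qed
  show ?thesis
  proof (intro set_eqI iffI)
    fix w assume "w \<in> hatC16 \<phi>"
    then obtain x where x: "x \<in> C16" "w = \<phi> (normalized_rejection W x)" by (auto simp: hatC16_def)
    from x(1) show "w \<in> F.demicube"
      by (rule C16_D) (simp only: x(2) img F.sign_point_in_demicube)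
  next
    fix w assume "w \<in> F.demicube"
    then obtain c where c: "w = (\<lambda>(p, q, r, s). F.sign_point p q r s (- (p * q * r * s))) c"
      "c \<in> signs \<times> signs \<times> signs \<times> signs"
      unfolding F.demicube_def by (rule imageE)
    obtain p q r s where "c = (p, q, r, s)" by (rule prod_cases4)
    with c have w: "w = F.sign_point p q r s (- (p * q * r * s))"
      and sg: "p \<in> signs" "q \<in> signs" "r \<in> signs" "s \<in> signs"
      by (simp_all only: prod.case mem_Sigma_iff)
    from sg show "w \<in> hatC16 \<phi>"
    proof (rule C16_I)
      fix x assume x: "x \<in> C16" "x \<bullet> perp_frame 4 = p / 2" "x \<bullet> perp_frame 5 = q / 2"
        "x \<bullet> perp_frame 6 = r / 2" "x \<bullet> perp_frame 7 = s / 2" "x \<bullet> perp_frame 0 = - (p * q * r * s) / 2"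
      have "w = \<phi> (normalized_rejection W x)" using img[OF sg x(2-)] w by simp
      then show "w \<in> hatC16 \<phi>" unfolding hatC16_def using x(1) by blast
    qed
  qed
qed

section \<open>Polarization values and universal duality of the two codes\<close>

theorem theorem4p6:
  fixes \<phi> :: "real^8 \<Rightarrow> real^5"
  assumes "identifies_W_perp \<phi>"
  shows "(\<forall>h. potential h \<and> nth_deriv_pos 4 h \<longrightarrow>
            polarization h (hatC10 \<phi>) = 5 * h (-1 / sqrt 5) + 5 * h (1 / sqrt 5) \<and>
            (\<exists>x\<in>sphere 0 1. U_pot h x (hatC10 \<phi>) = 5 * h (-1 / sqrt 5) + 5 * h (1 / sqrt 5)) \<and>
            polarization h (C32 \<phi>) = 16 * h (-1 / sqrt 5) + 16 * h (1 / sqrt 5) \<and>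
            (\<exists>x\<in>sphere 0 1. U_pot h x (C32 \<phi>) = 16 * h (-1 / sqrt 5) + 16 * h (1 / sqrt 5)) \<and>
            polarization h (hatC10 \<phi>) / 10 = polarization h (C32 \<phi>) / 32 \<and>
            polarization h (C32 \<phi>) / 32 = polarization h (hatC16 \<phi>) / 16)
       \<and> universal_polar_dual_pair (C32 \<phi>) (hatC10 \<phi>)"
proof -
  interpret F: orthonormal_frame "\<lambda>k. \<phi> (perp_frame k)" by (rule orthonormal_frame_image[OF assms])
  have c10: "hatC10 \<phi> = F.cross_polytope" and c16: "hatC16 \<phi> = F.demicube"
    using assms by (rule hatC10_eq_cross_polytope hatC16_eq_demicube)+
  then have c32: "C32 \<phi> = F.cube" by (simp add: C32_def F.cube_def)
  have a: "0 < 1 / sqrt (5::real)" "1 / sqrt (5::real) < 1" by simp_all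
  have ne: "F.cube \<noteq> {}" "F.cross_polytope \<noteq> {}"
    using F.card_cube F.card_cross_polytope by auto
  show ?thesis
  proof (intro conjI allI impI)
    fix h :: "real \<Rightarrow> ereal" assume "potential h \<and> nth_deriv_pos 4 h"
    then have h: "potential h" "nth_deriv_pos 4 h" by auto
    \<comment> \<open>One \<open>V\<close> is fixed for all three codes, so that their normalized
      values can be compared.\<close>
    obtain V where V: "h (- (1 / sqrt 5)) + h (1 / sqrt 5) = ereal V"
      using U_pot_cubature_bound[OF h a F.cubature_cube] by metis
    have pol: "polarization h X = ereal (r * V) \<and> (\<exists>x\<in>sphere 0 1. U_pot h x X = ereal (r * V))"
      if X: "cubature_three (1 / sqrt 5) X" "two_level_points (1 / sqrt 5) X \<noteq> {}" and r: "real (card X) = 2 * r"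
      for X :: "(real^5) set" and r
    proof -
      obtain V' where V': "h (- (1 / sqrt 5)) + h (1 / sqrt 5) = ereal V'"
        and p: "polarization h X = ereal (real (card X) * V' / 2)"
          "\<exists>x\<in>sphere 0 1. U_pot h x X = ereal (real (card X) * V' / 2)"
        by (rule cubature_polarization[OF h a X])
      have "V' = V" using V V' by simp
      with p r show ?thesis by simp
    qed
    have p10: "polarization h (hatC10 \<phi>) = ereal (5 * V)" "\<exists>x\<in>sphere 0 1. U_pot h x (hatC10 \<phi>) = ereal (5 * V)"
      using pol[OF F.cubature_cross_polytope, of 5] ne
      by (simp_all add: c10 F.two_level_cross_polytope F.card_cross_polytope)
    have p32: "polarization h (C32 \<phi>) = ereal (16 * V)" "\<exists>x\<in>sphere 0 1. U_pot h x (C32 \<phi>) = ereal (16 * V)"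
      using pol[OF F.cubature_cube, of 16] ne
      by (simp_all add: c32 F.two_level_cube F.card_cube)
    have p16: "polarization h (hatC16 \<phi>) = ereal (8 * V)"
      using pol[OF F.cubature_demicube F.two_level_demicube_nonempty, of 8]
      by (simp add: c16 F.card_demicube)
    \<comment> \<open>Extended multiplication does not distribute in general; finiteness of the sum
      \<open>V\<close> makes both potential values real.\<close>
    have val: "c * h (-1 / sqrt 5) + c * h (1 / sqrt 5) = ereal (r * V)" if "c = ereal r" for c r
      using V by (cases "h (- (1 / sqrt 5))"; cases "h (1 / sqrt 5)") (auto simp: that distrib_left)
    \<comment> \<open>The binary numerals are 5 and 16.\<close>
    note v5 = val[OF numeral_eq_ereal, of "num.Bit1 (num.Bit0 num.One)"]
      and v16 = val[OF numeral_eq_ereal, of "num.Bit0 (num.Bit0 (num.Bit0 (num.Bit0 num.One)))"]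
    show "polarization h (hatC10 \<phi>) = 5 * h (-1 / sqrt 5) + 5 * h (1 / sqrt 5)"
      "\<exists>x\<in>sphere 0 1. U_pot h x (hatC10 \<phi>) = 5 * h (-1 / sqrt 5) + 5 * h (1 / sqrt 5)"
      unfolding v5 by (fact p10)+
    show "polarization h (C32 \<phi>) = 16 * h (-1 / sqrt 5) + 16 * h (1 / sqrt 5)"
      "\<exists>x\<in>sphere 0 1. U_pot h x (C32 \<phi>) = 16 * h (-1 / sqrt 5) + 16 * h (1 / sqrt 5)"
      unfolding v16 by (fact p32)+
    show "polarization h (hatC10 \<phi>) / 10 = polarization h (C32 \<phi>) / 32"
      "polarization h (C32 \<phi>) / 32 = polarization h (hatC16 \<phi>) / 16"
      unfolding p10 p32 p16 by simp_all
  next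
    have "minimizers h F.cube = F.cross_polytope \<and> minimizers h F.cross_polytope = F.cube"
      if "potential h" "strictly_absolutely_monotone h" for h
    proof -
      have h: "potential h" "nth_deriv_pos 4 h" using that by (auto simp: strictly_absolutely_monotone_def)
      show ?thesis
        using cubature_minimizers[OF h a F.cubature_cube] cubature_minimizers[OF h a F.cubature_cross_polytope] ne
        unfolding F.two_level_cube F.two_level_cross_polytope by simp
    qed
    then show "universal_polar_dual_pair (C32 \<phi>) (hatC10 \<phi>)"
      unfolding universal_polar_dual_pair_def c10 c32 by blast
  qed
qed

end
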